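(* Let $d>1$ be an integer and let $n_1,\dots,n_p$ be positive integers with $\sum_{k=1}^p n_k=d+1$. Set $$\tilde E\{n_1,\dots,n_p\}=\Bigl\{(\zeta_1,\dots,\zeta_p,\alpha_{1,1},\dots,\alpha_{1,n_1},\alpha_{2,1},\dots,\alpha_{p,n_p})\in\mathbb{C}^{d+p+1}\Bigm| \zeta_1,\dots,\zeta_p \text{ mutually distinct},\ \sum_{k=1}^p\alpha_{k,1}=1,\ \alpha_{k,n_k}\ne 0\ (k=1,\dots,p)\Bigr\}.$$ Let $\Pi:\tilde E\{n_1,\dots,n_p\}\to C\{n_1,\dots,n_p\}$ be the natural projection, sending a point $(\zeta_k,\alpha_{k,\ell})$ to the rational function $$R(z)=z-\frac{\hat P(z)}{Q(z)},\qquad \hat P(z)=\prod_{j=1}^p(z-\zeta_j)^{n_j},\qquad Q(z)=\sum_{k=1}^p\Bigl\{\Bigl(\sum_{n=0}^{n_k-1}\alpha_{k,n_k-n}(z-\zeta_k)^n\Bigr)\prod_{j\ne k}(z-\zeta_j)^{n_j}\Bigr\}.$$ Then $\Pi$ is a holomorphic surjection, with respect to the system of coefficient parameters on $C\{n_1,\dots,n_p\}$. Moreover, $C\{n_1,\dots,n_p\}$ has a complex manifold structure such that $\Pi$ is a finite-sheeted holomorphic covering projection.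
   Context: For an integer $d>1$, $\mathrm{Rat}_d$ denotes the set of all rational functions of degree $d$ over $\mathbb{C}$. The canonical family $C_d$ is the set of all $R=P/Q\in \mathrm{Rat}_d$ with polynomials $P(z)=a_dz^d+\cdots+a_0$ and $Q(z)=z^d+b_{d-1}z^{d-1}+\cdots+b_0$, where $Q$ is monic of degree exactly $d$, $P$ has degree at most $d$, and the resultant of $P$ and $Q$ is nonzero (i.e. $P$ and $Q$ have no common zero). The vector $(a_d,\dots,a_0,b_{d-1},\dots,b_0)\in\mathbb{C}^{2d+1}$ is called the system of coefficient parameters for $C_d$; through it $C_d$, and every subset of it, is regarded as a subset of $\mathbb{C}^{2d+1}$. Every $R=P/Q\in C_d$ can be written $R(z)=z-\hat P(z)/Q(z)$ with $\hat P(z)=zQ(z)-P(z)=\prod_{j=1}^p (z-\zeta_j)^{n_j}$ monic of degree $d+1$, where the $\zeta_j\in\mathbb{C}$ are mutually distinct (they are the fixed points of $R$) and the $n_j$ are positive integers with $\sum_{j=1}^p n_j=d+1$. The overlap type of $R$ is the collection (unordered, with repetition) $\{n_1,\dots,n_p\}$, and $$C\{n_1,\dots,n_p\}=\{R\in C_d\mid \text{the overlap type of } R \text{ is } \{n_1,\dots,n_p\}\}.$$ The formula for $Q$ in the definition of $\Pi$ is equivalent to the partial fractions decomposition $\frac{Q(z)}{\hat P(z)}=\sum_{k=1}^p\sum_{\ell=1}^{n_k}\frac{\alpha_{k,\ell}}{(z-\zeta_k)^\ell}$. *)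

theory Defs
  imports
    "HOL-Analysis.Analysis"
    "HOL-Computational_Algebra.Computational_Algebra"
    "HOL-Computational_Algebra.Field_as_Ring"
begin

section \<open>Holomorphic maps between subsets of complex coordinate spaces\<close>

text \<open>
  For a finite index set \<open>I\<close>, the space \<open>\<complex>\<^sup>I\<close> is realised as the set of functions
  vanishing outside \<open>I\<close>. The subspace topology inherited from the product topology
  on functions is the usual one.
\<close>

definition cvec :: "'i set \<Rightarrow> ('i \<Rightarrow> complex) set" where
  "cvec I = {x. \<forall>i. i \<notin> I \<longrightarrow> x i = 0}"

text \<open>
  Complex (total) differentiability: \<open>f (y) = f (x) + L (y - x) + o (\<parallel>y - x\<parallel>)\<close> for \<open>y \<rightarrow> x\<close>
  in \<open>\<complex>\<^sup>I\<close>, where \<open>L\<close> is the complex-linear form with coefficients \<open>c\<close>.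
\<close>

definition cdifferentiable :: "'i set \<Rightarrow> (('i \<Rightarrow> complex) \<Rightarrow> complex) \<Rightarrow> ('i \<Rightarrow> complex) \<Rightarrow> bool" where
  "cdifferentiable I f x \<longleftrightarrow>
     (\<exists>c :: 'i \<Rightarrow> complex. \<forall>e>0. \<exists>\<delta>>0. \<forall>y\<in>cvec I.
        (\<Sum>i\<in>I. norm (y i - x i)) < \<delta> \<longrightarrow>
        norm (f y - f x - (\<Sum>i\<in>I. c i * (y i - x i))) \<le> e * (\<Sum>i\<in>I. norm (y i - x i)))"

text \<open>
  A map on an arbitrary subset \<open>S\<close> of \<open>\<complex>\<^sup>I\<close> is holomorphic if it is locally the restriction of a
  holomorphic map on an open subset of \<open>\<complex>\<^sup>I\<close>. For open \<open>S\<close> this is ordinary holomorphy, for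
  a complex submanifold \<open>S\<close> it is holomorphy on \<open>S\<close>.
\<close>

definition holo_on :: "'i set \<Rightarrow> ('i \<Rightarrow> complex) set \<Rightarrow> (('i \<Rightarrow> complex) \<Rightarrow> ('j \<Rightarrow> complex)) \<Rightarrow> bool" where
  "holo_on I S f \<longleftrightarrow> S \<subseteq> cvec I \<and>
     (\<forall>x\<in>S. \<exists>W g. openin (top_of_set (cvec I)) W \<and> x \<in> W \<and>
        (\<forall>y\<in>W. \<forall>j. cdifferentiable I (\<lambda>z. g z j) y) \<and>
        (\<forall>y\<in>W \<inter> S. g y = f y))"


section \<open>Complex manifolds and holomorphic coverings\<close>

text \<open>
  A manifold is a subset \<open>M\<close> of a topological space, with the subspace topology, together with an
  atlas. Charts take values in \<open>\<complex>\<^sup>m\<close>, that is, in \<open>cvec {..<m}\<close>.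
\<close>

type_synonym 'a chart = "'a set \<times> ('a \<Rightarrow> nat \<Rightarrow> complex)"

definition complex_chart :: "nat \<Rightarrow> 'a::topological_space set \<Rightarrow> 'a chart \<Rightarrow> bool" where
  "complex_chart m M = (\<lambda>(U, \<phi>).
     openin (top_of_set M) U \<and>
     openin (top_of_set (cvec {..<m})) (\<phi> ` U) \<and>
     homeomorphism U (\<phi> ` U) \<phi> (inv_into U \<phi>))"

text \<open>
  The Hausdorff property and the second axiom of countability are inherited by \<open>M\<close> from the
  ambient type.
\<close>

definition complex_manifold ::
    "nat \<Rightarrow> 'a::{t2_space,second_countable_topology} set \<Rightarrow> 'a chart set \<Rightarrow> bool" where
  "complex_manifold m M \<A> \<longleftrightarrow>
     (\<forall>c\<in>\<A>. complex_chart m M c) \<and>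
     (\<Union>c\<in>\<A>. fst c) = M \<and>
     (\<forall>(U, \<phi>)\<in>\<A>. \<forall>(V, \<psi>)\<in>\<A>. holo_on {..<m} (\<phi> ` (U \<inter> V)) (\<psi> \<circ> inv_into U \<phi>))"

text \<open>
  Here \<open>A\<close> and \<open>B\<close> are open subsets of \<open>m\<close>- and \<open>k\<close>-dimensional manifolds with atlases
  \<open>\<A>\<close> and \<open>\<B>\<close>.
\<close>

definition holomorphic_map :: "nat \<Rightarrow> 'a::topological_space set \<Rightarrow> 'a chart set \<Rightarrow>
    'b::topological_space set \<Rightarrow> 'b chart set \<Rightarrow> ('a \<Rightarrow> 'b) \<Rightarrow> bool" where
  "holomorphic_map m A \<A> B \<B> f \<longleftrightarrow>
     continuous_on A f \<and> f ` A \<subseteq> B \<and>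
     (\<forall>(U, \<phi>)\<in>\<A>. \<forall>(V, \<psi>)\<in>\<B>.
        holo_on {..<m} (\<phi> ` (A \<inter> U \<inter> f -` V)) (\<psi> \<circ> f \<circ> inv_into U \<phi>))"

text \<open>
  A holomorphic covering is a topological covering by a holomorphic map whose continuous local
  inverses are holomorphic; in particular it maps each sheet over an evenly covered open
  set biholomorphically onto that set.
\<close>

definition holomorphic_covering :: "nat \<Rightarrow>
    'a::{t2_space,second_countable_topology} set \<Rightarrow> 'a chart set \<Rightarrow>
    'b::{t2_space,second_countable_topology} set \<Rightarrow> 'b chart set \<Rightarrow> ('a \<Rightarrow> 'b) \<Rightarrow> bool" where
  "holomorphic_covering m M \<A> N \<B> f \<longleftrightarrow>
     complex_manifold m M \<A> \<and> complex_manifold m N \<B> \<and>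
     covering_space M f N \<and>
     holomorphic_map m M \<A> N \<B> f \<and>
     (\<forall>U V q. openin (top_of_set M) U \<and> openin (top_of_set N) V \<and> homeomorphism U V f q \<longrightarrow>
        holomorphic_map m V \<B> U \<A> q)"

definition finite_sheeted :: "'a set \<Rightarrow> ('a \<Rightarrow> 'b) \<Rightarrow> 'b set \<Rightarrow> bool" where
  "finite_sheeted M f N \<longleftrightarrow>
     (\<exists>s. \<forall>y\<in>N. finite {x\<in>M. f x = y} \<and> card {x\<in>M. f x = y} = s)"

text \<open>
  The structure of a complex submanifold of \<open>\<complex>\<^sup>I\<close>: all charts that are biholomorphic with respect
  to the ambient coordinates.
\<close>

definition submanifold_charts :: "'i set \<Rightarrow> nat \<Rightarrow> ('i \<Rightarrow> complex) set \<Rightarrow> ('i \<Rightarrow> complex) chart set" where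
  "submanifold_charts I m S = {(U, \<phi>).
     complex_chart m S (U, \<phi>) \<and> holo_on I U \<phi> \<and> holo_on {..<m} (\<phi> ` U) (inv_into U \<phi>)}"


section \<open>The canonical family of rational functions\<close>

text \<open>
  Rational functions are elements of the fraction field of the polynomial ring.
  \<open>canonical_rep d R P Q\<close> says that \<open>R = P / Q\<close> as in the definition of the canonical family;
  nonvanishing of the resultant is expressed as absence of common zeros.
\<close>

definition canonical_rep :: "nat \<Rightarrow> complex poly fract \<Rightarrow> complex poly \<Rightarrow> complex poly \<Rightarrow> bool" where
  "canonical_rep d R P Q \<longleftrightarrow>
     R = Fract P Q \<and> degree P \<le> d \<and> degree Q = d \<and> lead_coeff Q = 1 \<and>
     \<not> (\<exists>z. poly P z = 0 \<and> poly Q z = 0)"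

definition canonical_family :: "nat \<Rightarrow> complex poly fract set" where
  "canonical_family d = {R. \<exists>P Q. canonical_rep d R P Q}"

lemma canonical_rep_unique:
  assumes "canonical_rep d R P Q" "canonical_rep d R P' Q'"
  shows "P = P' \<and> Q = Q'"
proof -
  have nz: "F \<noteq> 0" if "canonical_rep d R G F" for F G
    using that by (auto simp: canonical_rep_def)
  have cop: "coprime F G" if "canonical_rep d R G F" for F G
  proof (rule coprimeI)
    fix h assume h: "h dvd F" "h dvd G"
    have "degree h = 0"
    proof (rule ccontr)
      assume "degree h \<noteq> 0"
      then have "\<not> constant (poly h)"
        by (simp add: constant_degree)
      then obtain z where "poly h z = 0"
        using fundamental_theorem_of_algebra by blast
      then have "poly F z = 0" "poly G z = 0"
        using h by (auto simp: dvd_def)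
      then show False
        using that by (auto simp: canonical_rep_def)
    qed
    moreover have "h \<noteq> 0"
      using h nz[OF that] by auto
    ultimately show "is_unit h"
      by (simp add: is_unit_iff_degree)
  qed
  have eq: "P * Q' = P' * Q"
    using assms nz[OF assms(1)] nz[OF assms(2)]
    by (auto simp: canonical_rep_def eq_fract)
  have "Q dvd Q'"
    using coprime_dvd_mult_right_iff[OF cop[OF assms(1)], of Q'] eq by simp
  then obtain u where u: "Q' = Q * u" ..
  with nz[OF assms(2)] have "u \<noteq> 0" by auto
  have "degree u = 0"
    using u assms nz[OF assms(1)] \<open>u \<noteq> 0\<close> by (simp add: canonical_rep_def degree_mult_eq)
  moreover have "lead_coeff u = 1"
  proof -
    have "lead_coeff Q = 1" "lead_coeff Q' = 1"
      using assms unfolding canonical_rep_def by blast+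
    then show ?thesis
      unfolding u lead_coeff_mult by simp
  qed
  ultimately have "u = 1"
    by (auto elim!: degree_eq_zeroE simp: one_pCons)
  with u eq nz[OF assms(1)] show ?thesis by simp
qed

datatype coeff_index = Num_coeff nat | Den_coeff nat

instance coeff_index :: countable
  by countable_datatype

definition coeff_indices :: "nat \<Rightarrow> coeff_index set" where
  "coeff_indices d = Num_coeff ` {..d} \<union> Den_coeff ` {..<d}"

text \<open>
  The system of coefficient parameters \<open>(a\<^sub>d, \<dots>, a\<^sub>0, b\<^bsub>d-1\<^esub>, \<dots>, b\<^sub>0)\<close>, with \<open>a\<^sub>i\<close>
  at index \<open>Num_coeff i\<close> and \<open>b\<^sub>i\<close> at index \<open>Den_coeff i\<close>. It is a point
  of \<open>\<complex>\<^sup>2\<^sup>d\<^sup>+\<^sup>1\<close>, realised as \<open>cvec (coeff_indices d)\<close>.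
\<close>

definition coeff_vector :: "nat \<Rightarrow> complex poly \<Rightarrow> complex poly \<Rightarrow> coeff_index \<Rightarrow> complex" where
  "coeff_vector d P Q = (\<lambda>i. case i of
     Num_coeff j \<Rightarrow> if j \<le> d then coeff P j else 0
   | Den_coeff j \<Rightarrow> if j < d then coeff Q j else 0)"

lemma coeff_vector_in_cvec: "coeff_vector d P Q \<in> cvec (coeff_indices d)"
  by (auto simp: coeff_vector_def cvec_def coeff_indices_def split: coeff_index.splits)

definition coeff_params :: "nat \<Rightarrow> complex poly fract \<Rightarrow> coeff_index \<Rightarrow> complex" where
  "coeff_params d R = (THE c. \<exists>P Q. canonical_rep d R P Q \<and> c = coeff_vector d P Q)"

definition zero_multiplicities :: "complex poly \<Rightarrow> nat multiset" where
  "zero_multiplicities F = image_mset (\<lambda>z. order z F) (mset_set {z. poly F z = 0})"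

definition overlap_type :: "nat \<Rightarrow> complex poly fract \<Rightarrow> nat multiset" where
  "overlap_type d R =
     (THE t. \<exists>P Q. canonical_rep d R P Q \<and> t = zero_multiplicities ([:0, 1:] * Q - P))"

definition overlap_class :: "nat \<Rightarrow> nat \<Rightarrow> (nat \<Rightarrow> nat) \<Rightarrow> complex poly fract set" where
  "overlap_class d p n =
     {R \<in> canonical_family d. overlap_type d R = image_mset n (mset_set {1..p})}"


section \<open>The parameter space and the projection\<close>

datatype param_index = Zeta nat | Alpha nat nat

instance param_index :: countable
  by countable_datatype

definition param_indices :: "nat \<Rightarrow> (nat \<Rightarrow> nat) \<Rightarrow> param_index set" where
  "param_indices p n =
     Zeta ` {1..p} \<union> {Alpha k l | k l. k \<in> {1..p} \<and> l \<in> {1..n k}}"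

definition E_tilde :: "nat \<Rightarrow> (nat \<Rightarrow> nat) \<Rightarrow> (param_index \<Rightarrow> complex) set" where
  "E_tilde p n = {x \<in> cvec (param_indices p n).
     inj_on (\<lambda>k. x (Zeta k)) {1..p} \<and>
     (\<Sum>k=1..p. x (Alpha k 1)) = 1 \<and>
     (\<forall>k\<in>{1..p}. x (Alpha k (n k)) \<noteq> 0)}"

definition P_hat :: "nat \<Rightarrow> (nat \<Rightarrow> nat) \<Rightarrow> (param_index \<Rightarrow> complex) \<Rightarrow> complex poly" where
  "P_hat p n x = (\<Prod>j=1..p. [:- x (Zeta j), 1:] ^ n j)"

definition Q_poly :: "nat \<Rightarrow> (nat \<Rightarrow> nat) \<Rightarrow> (param_index \<Rightarrow> complex) \<Rightarrow> complex poly" where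
  "Q_poly p n x =
     (\<Sum>k=1..p. (\<Sum>i=0..n k - 1. smult (x (Alpha k (n k - i))) ([:- x (Zeta k), 1:] ^ i)) *
               (\<Prod>j\<in>{1..p} - {k}. [:- x (Zeta j), 1:] ^ n j))"

definition Pi_proj :: "nat \<Rightarrow> (nat \<Rightarrow> nat) \<Rightarrow> (param_index \<Rightarrow> complex) \<Rightarrow> complex poly fract" where
  "Pi_proj p n x = Fract [:0, 1:] 1 - Fract (P_hat p n x) (Q_poly p n x)"

end

theory Submission
  imports Defs "HOL-Library.Landau_Symbols" "HOL-Combinatorics.Permutations"
begin

text \<open>
  Write \<open>R = z - F / Q\<close> with \<open>F\<close> monic of degree \<open>d + 1\<close>. The polynomial \<open>F\<close> is determined by its zeros
  \<open>\<zeta>\<^sub>k\<close> and their multiplicities \<open>n\<^sub>k\<close>, and then \<open>Q\<close> is determined by the partial fractions coefficients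
  \<open>\<alpha>\<^bsub>k,l\<^esub>\<close> of \<open>Q / F\<close>. Monicity of \<open>Q\<close> means \<open>\<Sum>\<^sub>k \<alpha>\<^bsub>k,1\<^esub> = 1\<close>, and \<open>Q (\<zeta>\<^sub>k) \<noteq> 0\<close> means
  that the top coefficient at \<open>\<zeta>\<^sub>k\<close> does not vanish. Hence a point of the parameter space is the
  same as a rational function of the overlap class together with an enumeration of its fixed points
  that puts a point of multiplicity \<open>n\<^sub>k\<close> in place \<open>k\<close> (\<open>Pi_proj_surj\<close>). Two such enumerations differ
  by a unique permutation \<open>\<sigma>\<close> of the indices with \<open>n \<circ> \<sigma> = n\<close>, so the projection is the quotient
  map of a free action of a finite group by coordinate permutations (\<open>coeff_map_fibre\<close>,
  \<open>relabel_free\<close>).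

  The parameter space is an open subset of an affine hyperplane, hence a complex manifold with a
  single chart. The quotient by a finite free group of holomorphic maps is then a finite covering, and
  the inverses of the sheets, followed by the chart, form a holomorphic atlas of the base, because any
  two local lifts differ by a group element (\<open>lift_locally_in_G\<close>, \<open>holomorphic_covering_quotient\<close>).

  It remains to see that the topology that the overlap class inherits from the coefficient space is
  the quotient topology, that is, that the projection is open onto its image. This follows from
  properness (\<open>coeff_map_proper\<close>): if the coefficients converge within the overlap class, the zeros
  \<open>\<zeta>\<^sub>k\<close> stay bounded, they cannot collide in the limit since the limit has \<open>p\<close> distinct fixed points,
  and the \<open>\<alpha>\<^bsub>k,l\<^esub>\<close> stay bounded because partial fractions are linearly independent.
\<close>

section \<open>Complex differentiability on coordinate spaces\<close>

lemma tendsto_fun_iff: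
  fixes f :: "'a \<Rightarrow> 'b \<Rightarrow> 'c::topological_space"
  shows "(f \<longlongrightarrow> l) F \<longleftrightarrow> (\<forall>i. ((\<lambda>x. f x i) \<longlongrightarrow> l i) F)"
  using limitin_componentwise[of "\<lambda>_. euclidean" UNIV f l F]
  by (simp add: euclidean_product_topology)

text \<open>
  Complex differentiability is restated with a Landau symbol along the filter of points of
  \<open>\<complex>\<^sup>I\<close> that approach \<open>x\<close>, so that sums, products and composites reduce to the calculus of
  \<open>o\<close> and \<open>O\<close>. The distance is complex-valued because both sides of a Landau symbol have the same type.
\<close>

definition cnear :: "'i set \<Rightarrow> ('i \<Rightarrow> complex) \<Rightarrow> ('i \<Rightarrow> complex) filter" where
  "cnear I x = inf (nhds x) (principal (cvec I))"

definition cdist :: "'i set \<Rightarrow> ('i \<Rightarrow> complex) \<Rightarrow> ('i \<Rightarrow> complex) \<Rightarrow> complex" where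
  "cdist I x y = complex_of_real (\<Sum>i\<in>I. norm (y i - x i))"

lemma norm_cdist: "norm (cdist I x y) = (\<Sum>i\<in>I. norm (y i - x i))"
  unfolding cdist_def by (simp only: norm_of_real) (simp add: sum_nonneg)

lemma eventually_cnear: "eventually P (cnear I x) \<longleftrightarrow> (\<forall>\<^sub>F y in nhds x. y \<in> cvec I \<longrightarrow> P y)"
  by (simp add: cnear_def eventually_inf_principal)

text \<open>
  On \<open>\<complex>\<^sup>I\<close> with \<open>I\<close> finite the topology of pointwise convergence is given by the \<open>l\<^sup>1\<close> distance:
  convergence of the sum forces each coordinate in \<open>I\<close> to converge, and the other coordinates
  vanish identically.
\<close>

lemma eventually_cnear_iff:
  assumes "finite I" "x \<in> cvec I"
  shows "eventually P (cnear I x) \<longleftrightarrow>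
    (\<exists>\<delta>>0. \<forall>y\<in>cvec I. (\<Sum>i\<in>I. norm (y i - x i)) < \<delta> \<longrightarrow> P y)"
proof
  let ?N = "\<lambda>y. \<Sum>i\<in>I. norm (y i - x i)"
  let ?F = "inf (filtercomap ?N (nhds 0)) (principal (cvec I))"
  assume ev: "eventually P (cnear I x)"
  have "((\<lambda>y. y i) \<longlongrightarrow> x i) ?F" for i
  proof (cases "i \<in> I")
    case True
    have N: "(?N \<longlongrightarrow> 0) ?F"
      by (rule tendsto_mono[OF inf_le1 filterlim_filtercomap])
    have le: "norm (y i - x i) \<le> ?N y" for y
      using member_le_sum[of i I "\<lambda>i. norm (y i - x i)"] True assms(1) by simp
    have "((\<lambda>y. y i - x i) \<longlongrightarrow> 0) ?F"
      by (rule Lim_null_comparison[OF always_eventually N]) (use le in blast)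
    then show ?thesis
      by (simp add: LIM_zero_iff)
  next
    case False
    have "\<forall>\<^sub>F y in ?F. y i = x i"
      using False assms(2) by (auto simp: eventually_inf_principal cvec_def)
    then show ?thesis
      by (rule tendsto_eventually)
  qed
  then have "filterlim (\<lambda>y. y) (nhds x) ?F"
    by (simp add: tendsto_fun_iff)
  with ev have "\<forall>\<^sub>F y in ?F. y \<in> cvec I \<longrightarrow> P y"
    unfolding eventually_cnear filterlim_iff by blast
  then obtain Q where "eventually Q (nhds 0)" and Q: "\<And>y. Q (?N y) \<Longrightarrow> y \<in> cvec I \<Longrightarrow> P y"
    by (auto simp: eventually_inf_principal eventually_filtercomap)
  then obtain \<delta> where "\<delta> > 0" "\<And>r. dist r 0 < \<delta> \<Longrightarrow> Q r"
    unfolding eventually_nhds_metric by blast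
  then show "\<exists>\<delta>>0. \<forall>y\<in>cvec I. ?N y < \<delta> \<longrightarrow> P y"
    using Q by (intro exI[of _ \<delta>]) (auto simp: sum_nonneg)
next
  let ?N = "\<lambda>y. \<Sum>i\<in>I. norm (y i - x i)"
  assume "\<exists>\<delta>>0. \<forall>y\<in>cvec I. ?N y < \<delta> \<longrightarrow> P y"
  then obtain \<delta> where \<delta>: "\<delta> > 0" "\<And>y. y \<in> cvec I \<Longrightarrow> ?N y < \<delta> \<Longrightarrow> P y" by blast
  have "continuous_on UNIV ?N"
    by (intro continuous_intros continuous_on_product_coordinates)
  then have "open {y. ?N y < \<delta>}"
    by (intro open_Collect_less continuous_on_const)
  then have "\<forall>\<^sub>F y in nhds x. ?N y < \<delta>"
    using \<delta>(1) by (intro eventually_nhds_in_open[of "{y. ?N y < \<delta>}" x, simplified]) auto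
  then show "eventually P (cnear I x)"
    unfolding eventually_cnear by eventually_elim (use \<delta>(2) in blast)
qed

lemma cdifferentiable_iff_smallo:
  assumes "finite I" "x \<in> cvec I"
  shows "cdifferentiable I f x \<longleftrightarrow>
    (\<exists>c. (\<lambda>y. f y - f x - (\<Sum>i\<in>I. c i * (y i - x i))) \<in> o[cnear I x](cdist I x))"
  unfolding cdifferentiable_def smallo_def
  by (simp add: eventually_cnear_iff[OF assms] norm_cdist)

lemma coord_diff_bigo:
  assumes "finite I" "x \<in> cvec I"
  shows "(\<lambda>y. y i - x i) \<in> O[cnear I x](cdist I x)"
proof (rule bigoI[where c = 1])
  have "norm (y i - x i) \<le> 1 * norm (cdist I x y)" if "y \<in> cvec I" for y
  proof (cases "i \<in> I")
    case True
    then show ?thesis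
      using member_le_sum[of i I "\<lambda>i. norm (y i - x i)"] assms(1) by (simp add: norm_cdist)
  next
    case False
    then show ?thesis using that assms by (simp add: cvec_def)
  qed
  then show "\<forall>\<^sub>F y in cnear I x. norm (y i - x i) \<le> 1 * norm (cdist I x y)"
    by (auto simp: eventually_cnear)
qed

lemma cmult_in_smallo:
  fixes f :: "'a \<Rightarrow> complex"
  shows "f \<in> o[F](g) \<Longrightarrow> (\<lambda>x. c * f x) \<in> o[F](g)"
  by (cases "c = 0") simp_all

lemma cmult_in_bigo:
  fixes f :: "'a \<Rightarrow> complex"
  shows "f \<in> O[F](g) \<Longrightarrow> (\<lambda>x. c * f x) \<in> O[F](g)"
  by (cases "c = 0") simp_all

lemma linear_bigo:
  assumes "finite I" "x \<in> cvec I"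
  shows "(\<lambda>y. \<Sum>i\<in>I. c i * (y i - x i)) \<in> O[cnear I x](cdist I x)"
  by (intro big_sum_in_bigo cmult_in_bigo coord_diff_bigo assms)

lemma cdifferentiable_diff_bigo:
  assumes "finite I" "x \<in> cvec I"
    and "(\<lambda>y. f y - f x - (\<Sum>i\<in>I. c i * (y i - x i))) \<in> o[cnear I x](cdist I x)"
  shows "(\<lambda>y. f y - f x) \<in> O[cnear I x](cdist I x)"
  using sum_in_bigo(1)[OF landau_o.small_imp_big[OF assms(3)] linear_bigo[OF assms(1,2), of c]]
  by simp

lemma cdist_tendsto_0: "((\<lambda>y. cdist I x y) \<longlongrightarrow> 0) (cnear I x)"
proof -
  have "continuous_on UNIV (cdist I x)"
    unfolding cdist_def by (intro continuous_intros continuous_on_product_coordinates)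
  then have "(cdist I x \<longlongrightarrow> cdist I x x) (at x)"
    by (simp add: continuous_on_def)
  then have "(cdist I x \<longlongrightarrow> cdist I x x) (nhds x)"
    by (rule tendsto_at_iff_tendsto_nhds[THEN iffD1])
  moreover have "cdist I x x = 0" by (simp add: cdist_def)
  ultimately show ?thesis
    unfolding cnear_def by (intro tendsto_mono[OF inf_le1]) simp
qed

lemma bigo_cdist_tendsto_0:
  assumes "f \<in> O[cnear I x](cdist I x)"
  shows "(f \<longlongrightarrow> 0) (cnear I x)"
proof -
  have "cdist I x \<in> o[cnear I x](\<lambda>_. 1)"
    by (intro smalloI_tendsto) (use cdist_tendsto_0 in auto)
  then have "f \<in> o[cnear I x](\<lambda>_. 1)"
    by (rule landau_o.big_small_trans[OF assms])
  then show ?thesis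
    using smalloD_tendsto by fastforce
qed

lemma cdifferentiable_imp_tendsto:
  assumes "finite I" "x \<in> cvec I" "cdifferentiable I f x"
  shows "(f \<longlongrightarrow> f x) (cnear I x)"
proof -
  obtain c where "(\<lambda>y. f y - f x - (\<Sum>i\<in>I. c i * (y i - x i))) \<in> o[cnear I x](cdist I x)"
    using assms(3) unfolding cdifferentiable_iff_smallo[OF assms(1,2)] by blast
  then show ?thesis
    using bigo_cdist_tendsto_0[OF cdifferentiable_diff_bigo[OF assms(1,2)]]
    by (simp add: LIM_zero_iff)
qed

lemma cdifferentiable_const: "finite I \<Longrightarrow> x \<in> cvec I \<Longrightarrow> cdifferentiable I (\<lambda>_. a) x"
  unfolding cdifferentiable_iff_smallo by (intro exI[of _ "\<lambda>_. 0"]) simp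

lemma cdifferentiable_coord:
  assumes "finite I" "x \<in> cvec I"
  shows "cdifferentiable I (\<lambda>y. y j) x"
proof (cases "j \<in> I")
  case True
  have "(\<Sum>i\<in>I. (if i = j then 1 else 0) * (y i - x i)) = y j - x j" for y
    using True assms(1) by (simp add: if_distrib[of "\<lambda>z. z * _"] sum.delta cong: if_cong)
  then show ?thesis
    unfolding cdifferentiable_iff_smallo[OF assms]
    by (intro exI[of _ "\<lambda>i. if i = j then 1 else 0"]) simp
next
  case False
  have "\<forall>\<^sub>F y in cnear I x. y j - x j - (\<Sum>i\<in>I. 0 * (y i - x i)) = 0"
    using False assms(2) by (auto simp: eventually_cnear cvec_def)
  from landau_o.small.in_cong[OF this] show ?thesis
    unfolding cdifferentiable_iff_smallo[OF assms]
    by (intro exI[of _ "\<lambda>_. 0"]) (simp only: zero_in_smallo)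
qed

lemma cdifferentiable_add:
  assumes "finite I" "x \<in> cvec I" "cdifferentiable I f x" "cdifferentiable I g x"
  shows "cdifferentiable I (\<lambda>y. f y + g y) x"
proof -
  obtain c d where "(\<lambda>y. f y - f x - (\<Sum>i\<in>I. c i * (y i - x i))) \<in> o[cnear I x](cdist I x)"
    "(\<lambda>y. g y - g x - (\<Sum>i\<in>I. d i * (y i - x i))) \<in> o[cnear I x](cdist I x)"
    using assms(3,4) unfolding cdifferentiable_iff_smallo[OF assms(1,2)] by blast
  from sum_in_smallo(1)[OF this] show ?thesis
    unfolding cdifferentiable_iff_smallo[OF assms(1,2)]
    by (intro exI[of _ "\<lambda>i. c i + d i"]) (simp add: algebra_simps sum.distrib sum_subtractf)
qed

text \<open>
  From \<open>f y g y - f x g x = f x (g y - g x) + g x (f y - f x) + (f y - f x) (g y - g x)\<close>, where the last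
  product is \<open>O\<close> of the distance times a null function.
\<close>

lemma cdifferentiable_mult:
  assumes fin: "finite I" "x \<in> cvec I" and "cdifferentiable I f x" "cdifferentiable I g x"
  shows "cdifferentiable I (\<lambda>y. f y * g y) x"
proof -
  let ?o = "o[cnear I x](cdist I x)"
  obtain c d where c: "(\<lambda>y. f y - f x - (\<Sum>i\<in>I. c i * (y i - x i))) \<in> ?o"
    and d: "(\<lambda>y. g y - g x - (\<Sum>i\<in>I. d i * (y i - x i))) \<in> ?o"
    using assms(3,4) unfolding cdifferentiable_iff_smallo[OF fin] by blast
  have "(\<lambda>y. g y - g x) \<in> o[cnear I x](\<lambda>_. 1)"
    by (intro smalloI_tendsto)
       (use bigo_cdist_tendsto_0[OF cdifferentiable_diff_bigo[OF fin d]] in auto)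
  from landau_o.big_small_mult[OF cdifferentiable_diff_bigo[OF fin c] this]
  have "(\<lambda>y. (f y - f x) * (g y - g x)) \<in> ?o" by simp
  moreover have "(\<lambda>y. f x * (g y - g x - (\<Sum>i\<in>I. d i * (y i - x i)))) \<in> ?o"
    "(\<lambda>y. g x * (f y - f x - (\<Sum>i\<in>I. c i * (y i - x i)))) \<in> ?o"
    using c d by (cases "f x = 0"; simp)+ 
  ultimately have *: "(\<lambda>y. (f y - f x) * (g y - g x) + f x * (g y - g x - (\<Sum>i\<in>I. d i * (y i - x i)))
      + g x * (f y - f x - (\<Sum>i\<in>I. c i * (y i - x i)))) \<in> ?o"
    by (intro sum_in_smallo)
  have "(f y - f x) * (g y - g x) + f x * (g y - g x - (\<Sum>i\<in>I. d i * (y i - x i)))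
      + g x * (f y - f x - (\<Sum>i\<in>I. c i * (y i - x i)))
      = f y * g y - f x * g x - (\<Sum>i\<in>I. (f x * d i + g x * c i) * (y i - x i))" for y
    by (simp add: algebra_simps sum.distrib sum_subtractf sum_distrib_left)
  with * show ?thesis
    unfolding cdifferentiable_iff_smallo[OF fin]
    by (intro exI[of _ "\<lambda>i. f x * d i + g x * c i"]) simp
qed

lemma cdifferentiable_uminus:
  assumes "finite I" "x \<in> cvec I" "cdifferentiable I f x"
  shows "cdifferentiable I (\<lambda>y. - f y) x"
  using cdifferentiable_mult[OF assms(1,2) cdifferentiable_const[OF assms(1,2), of "-1"] assms(3)]
  by simp

lemma cdifferentiable_diff:
  assumes "finite I" "x \<in> cvec I" "cdifferentiable I f x" "cdifferentiable I g x"
  shows "cdifferentiable I (\<lambda>y. f y - g y) x"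
  using cdifferentiable_add[OF assms(1-3) cdifferentiable_uminus[OF assms(1,2,4)]] by simp

lemma cdifferentiable_sum:
  assumes "finite I" "x \<in> cvec I" "\<And>a. a \<in> A \<Longrightarrow> cdifferentiable I (f a) x"
  shows "cdifferentiable I (\<lambda>y. \<Sum>a\<in>A. f a y) x"
  using assms(3)
  by (induction A rule: infinite_finite_induct)
     (auto intro!: cdifferentiable_add cdifferentiable_const assms(1,2))

lemma tendsto_cnear_fun:
  assumes "finite I" "x \<in> cvec I" "\<And>j. cdifferentiable I (\<lambda>z. g z j) x" "\<And>y. g y \<in> cvec J"
  shows "filterlim g (cnear J (g x)) (cnear I x)"
  unfolding cnear_def[of J]
  by (intro filterlim_inf[THEN iffD2] conjI tendsto_fun_iff[THEN iffD2] allI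
        cdifferentiable_imp_tendsto assms(1-3))
     (simp add: filterlim_principal assms(4))

text \<open>
  The linear form of \<open>f\<close> is applied to the increments of \<open>g\<close>. Both the remainder of \<open>f\<close>, which
  is small compared with an increment that is itself \<open>O\<close> of the distance, and the image of the
  remainders of \<open>g\<close> are negligible. The values of \<open>g\<close> must lie in \<open>\<complex>\<^sup>J\<close>, since \<open>f\<close> is only controlled
  there.
\<close>

lemma cdifferentiable_compose:
  assumes I: "finite I" "x \<in> cvec I" and "finite J"
    and g: "\<And>j. cdifferentiable I (\<lambda>z. g z j) x" "\<And>y. g y \<in> cvec J"
    and f: "cdifferentiable J f (g x)"
  shows "cdifferentiable I (\<lambda>z. f (g z)) x"
proof -
  let ?o = "o[cnear I x](cdist I x)" and ?O = "O[cnear I x](cdist I x)"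
  have J: "finite J" "g x \<in> cvec J" by fact+
  have "\<forall>j. \<exists>c. (\<lambda>y. g y j - g x j - (\<Sum>i\<in>I. c i * (y i - x i))) \<in> ?o"
    using g(1) unfolding cdifferentiable_iff_smallo[OF I] by blast
  from choice[OF this]
  obtain c where c: "\<And>j. (\<lambda>y. g y j - g x j - (\<Sum>i\<in>I. c j i * (y i - x i))) \<in> ?o" by blast
  obtain d where "(\<lambda>y. f y - f (g x) - (\<Sum>j\<in>J. d j * (y j - g x j))) \<in> o[cnear J (g x)](cdist J (g x))"
    using f unfolding cdifferentiable_iff_smallo[OF J] by blast
  from landau_o.small.compose[OF this tendsto_cnear_fun[OF I g]]
  have "(\<lambda>y. f (g y) - f (g x) - (\<Sum>j\<in>J. d j * (g y j - g x j))) \<in> o[cnear I x](\<lambda>y. cdist J (g x) (g y))" .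
  moreover have "(\<lambda>y. cdist J (g x) (g y)) \<in> ?O"
    unfolding cdist_def[of J] of_real_sum
  proof (rule big_sum_in_bigo)
    fix j assume "j \<in> J"
    have "(\<lambda>y. g y j - g x j) \<in> ?O"
      by (rule cdifferentiable_diff_bigo[OF I c])
    then show "(\<lambda>y. complex_of_real (norm (g y j - g x j))) \<in> ?O"
      by (simp add: bigo_def)
  qed
  ultimately have "(\<lambda>y. f (g y) - f (g x) - (\<Sum>j\<in>J. d j * (g y j - g x j))) \<in> ?o"
    by (rule landau_o.small_big_trans)
  moreover have "(\<lambda>y. \<Sum>j\<in>J. d j * (g y j - g x j - (\<Sum>i\<in>I. c j i * (y i - x i)))) \<in> ?o"
    by (intro big_sum_in_smallo cmult_in_smallo c)
  ultimately have *: "(\<lambda>y. f (g y) - f (g x) - (\<Sum>j\<in>J. d j * (g y j - g x j)) +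
      (\<Sum>j\<in>J. d j * (g y j - g x j - (\<Sum>i\<in>I. c j i * (y i - x i))))) \<in> ?o"
    by (rule sum_in_smallo)
  have "(\<Sum>i\<in>I. (\<Sum>j\<in>J. d j * c j i) * (y i - x i)) =
      (\<Sum>j\<in>J. d j * (\<Sum>i\<in>I. c j i * (y i - x i)))" for y
    by (simp add: sum_distrib_left sum_distrib_right mult.assoc) (rule sum.swap)
  moreover have "(\<Sum>j\<in>J. d j * (u j - v j)) = (\<Sum>j\<in>J. d j * u j) - (\<Sum>j\<in>J. d j * v j)" for u v
    by (simp add: right_diff_distrib sum_subtractf)
  ultimately have "f (g y) - f (g x) - (\<Sum>j\<in>J. d j * (g y j - g x j)) +
      (\<Sum>j\<in>J. d j * (g y j - g x j - (\<Sum>i\<in>I. c j i * (y i - x i)))) =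
      f (g y) - f (g x) - (\<Sum>i\<in>I. (\<Sum>j\<in>J. d j * c j i) * (y i - x i))" for y
    by (simp only:) simp
  with * show ?thesis
    unfolding cdifferentiable_iff_smallo[OF I]
    by (intro exI[of _ "\<lambda>i. \<Sum>j\<in>J. d j * c j i"]) simp
qed


section \<open>Holomorphic maps on subsets\<close>

lemma cdifferentiable_imp_holo_on:
  assumes "S \<subseteq> cvec I" "\<And>y j. y \<in> cvec I \<Longrightarrow> cdifferentiable I (\<lambda>z. f z j) y"
  shows "holo_on I S f"
  unfolding holo_on_def
proof (intro conjI ballI)
  fix x assume "x \<in> S"
  then show "\<exists>W g. openin (top_of_set (cvec I)) W \<and> x \<in> W \<and>
      (\<forall>y\<in>W. \<forall>j. cdifferentiable I (\<lambda>z. g z j) y) \<and> (\<forall>y\<in>W \<inter> S. g y = f y)"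
    by - (rule exI[of _ "cvec I"], rule exI[of _ f], use assms in auto)
qed (fact assms(1))

lemma holo_on_imp_cvec: "holo_on I S f \<Longrightarrow> S \<subseteq> cvec I"
  by (simp add: holo_on_def)

lemma holo_onE:
  assumes "holo_on I S f" "x \<in> S"
  obtains W g where "openin (top_of_set (cvec I)) W" "x \<in> W"
    "\<forall>y\<in>W. \<forall>j. cdifferentiable I (\<lambda>z. g z j) y" "\<forall>y\<in>W \<inter> S. g y = f y"
proof -
  have "\<exists>W g. openin (top_of_set (cvec I)) W \<and> x \<in> W \<and>
      (\<forall>y\<in>W. \<forall>j. cdifferentiable I (\<lambda>z. g z j) y) \<and> (\<forall>y\<in>W \<inter> S. g y = f y)"
    using assms by (simp add: holo_on_def)
  then show thesis by (elim exE conjE) (rule that)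
qed

lemma holo_onI:
  assumes "S \<subseteq> cvec I"
    and "\<And>x. x \<in> S \<Longrightarrow> openin (top_of_set (cvec I)) (W x) \<and> x \<in> W x \<and>
      (\<forall>y\<in>W x. \<forall>j. cdifferentiable I (\<lambda>z. g x z j) y) \<and> (\<forall>y\<in>W x \<inter> S. g x y = f y)"
  shows "holo_on I S f"
  unfolding holo_on_def
proof (intro conjI ballI)
  show "\<exists>W g. openin (top_of_set (cvec I)) W \<and> x \<in> W \<and>
      (\<forall>y\<in>W. \<forall>j. cdifferentiable I (\<lambda>z. g z j) y) \<and> (\<forall>y\<in>W \<inter> S. g y = f y)" if "x \<in> S" for x
    by (rule exI[of _ "W x"], rule exI[of _ "g x"]) (rule assms(2)[OF that])
qed (fact assms(1))

lemma holo_on_subset: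
  assumes "holo_on I S f" "T \<subseteq> S"
  shows "holo_on I T f"
  unfolding holo_on_def
proof (intro conjI ballI)
  show "T \<subseteq> cvec I" using holo_on_imp_cvec[OF assms(1)] assms(2) by simp
  fix x assume "x \<in> T"
  with assms(2) have "x \<in> S" by blast
  then obtain W g where W: "openin (top_of_set (cvec I)) W" "x \<in> W"
    "\<forall>y\<in>W. \<forall>j. cdifferentiable I (\<lambda>z. g z j) y" "\<forall>y\<in>W \<inter> S. g y = f y"
    by (rule holo_onE[OF assms(1)])
  show "\<exists>W g. openin (top_of_set (cvec I)) W \<and> x \<in> W \<and>
      (\<forall>y\<in>W. \<forall>j. cdifferentiable I (\<lambda>z. g z j) y) \<and> (\<forall>y\<in>W \<inter> T. g y = f y)"
    by (rule exI[of _ W], rule exI[of _ g]) (use W assms(2) in blast)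
qed

lemma holo_on_cong: "(\<And>x. x \<in> S \<Longrightarrow> f x = g x) \<Longrightarrow> holo_on I S f \<longleftrightarrow> holo_on I S g"
  unfolding holo_on_def by simp

lemma holo_on_local:
  assumes "S \<subseteq> cvec I"
    and loc: "\<And>x. x \<in> S \<Longrightarrow> \<exists>U. openin (top_of_set S) U \<and> x \<in> U \<and> holo_on I U f"
  shows "holo_on I S f"
  unfolding holo_on_def
proof (intro conjI ballI)
  fix x assume "x \<in> S"
  with loc obtain U where U: "openin (top_of_set S) U" "x \<in> U" "holo_on I U f" by blast
  then obtain A where A: "open A" "U = S \<inter> A" by (auto simp: openin_open)
  obtain W g where W: "openin (top_of_set (cvec I)) W" "x \<in> W"
    "\<forall>y\<in>W. \<forall>j. cdifferentiable I (\<lambda>z. g z j) y" "\<forall>y\<in>W \<inter> U. g y = f y"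
    by (rule holo_onE[OF U(3,2)])
  have "openin (top_of_set (cvec I)) (W \<inter> A)"
    using W(1) A(1) by (rule openin_Int_open)
  with W A U show "\<exists>W g. openin (top_of_set (cvec I)) W \<and> x \<in> W \<and>
      (\<forall>y\<in>W. \<forall>j. cdifferentiable I (\<lambda>z. g z j) y) \<and> (\<forall>y\<in>W \<inter> S. g y = f y)"
    by - (rule exI[of _ "W \<inter> A"], rule exI[of _ g], auto)
qed (fact assms(1))

lemma holo_on_imp_continuous_on:
  assumes "finite I" "holo_on I S f"
  shows "continuous_on S f"
  unfolding continuous_on_def
proof
  fix x assume x: "x \<in> S"
  have S: "S \<subseteq> cvec I" using assms(2) by (simp add: holo_on_def)
  obtain W g where W: "openin (top_of_set (cvec I)) W" "x \<in> W"
    "\<forall>y\<in>W. \<forall>j. cdifferentiable I (\<lambda>z. g z j) y" "\<forall>y\<in>W \<inter> S. g y = f y"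
    by (rule holo_onE[OF assms(2) x])
  have xI: "x \<in> cvec I" using S x by blast
  have le: "at x within S \<le> cnear I x"
    unfolding cnear_def at_within_def using S by (intro inf_mono) auto
  have "(g \<longlongrightarrow> g x) (cnear I x)"
    unfolding tendsto_fun_iff
    using W(2) by (intro allI cdifferentiable_imp_tendsto[OF assms(1) xI] W(3)[rule_format])
  then have "(g \<longlongrightarrow> f x) (at x within S)"
    using tendsto_mono[OF le] W(2,4) x by simp
  moreover obtain A where A: "open A" "W = cvec I \<inter> A"
    using W(1) by (auto simp: openin_open)
  have "\<forall>\<^sub>F y in at x within S. y \<in> A"
    using A W(2) by (auto simp: eventually_at_topological)
  then have "\<forall>\<^sub>F y in at x within S. g y = f y"
    using W(4) A S by (auto simp: eventually_at_filter elim!: eventually_mono)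
  ultimately show "(f \<longlongrightarrow> f x) (at x within S)"
    by (metis (mono_tags, lifting) tendsto_cong)
qed

lemma holo_on_compose:
  assumes I: "finite I" and J: "finite J"
    and g: "holo_on I S g" and gT: "g ` S \<subseteq> T" and f: "holo_on J T f"
  shows "holo_on I S (f \<circ> g)"
  unfolding holo_on_def
proof (intro conjI ballI)
  show S: "S \<subseteq> cvec I" using g by (simp add: holo_on_def)
  have T: "T \<subseteq> cvec J" using f by (simp add: holo_on_def)
  fix x assume x: "x \<in> S"
  obtain W0 g0 where W0: "openin (top_of_set (cvec I)) W0" "x \<in> W0"
    "\<forall>y\<in>W0. \<forall>j. cdifferentiable I (\<lambda>z. g0 z j) y" "\<forall>y\<in>W0 \<inter> S. g0 y = g y"
    by (rule holo_onE[OF g x])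
  have W0I: "W0 \<subseteq> cvec I" using W0(1) by (rule openin_imp_subset)
  \<comment> \<open>The extension of \<open>g\<close> may leave \<open>\<complex>\<^sup>J\<close>; cutting off the coordinates outside \<open>J\<close> repairs this.\<close>
  define g1 where "g1 = (\<lambda>z j. if j \<in> J then g0 z j else 0)"
  have g1J: "g1 z \<in> cvec J" for z by (simp add: g1_def cvec_def)
  have g1d: "cdifferentiable I (\<lambda>z. g1 z j) y" if "y \<in> W0" for y j
    using W0(3)[rule_format, OF that, of j] cdifferentiable_const[OF I, of y 0] that W0I
    by (cases "j \<in> J") (auto simp: g1_def)
  have g1g: "g1 y = g y" if "y \<in> W0 \<inter> S" for y
  proof -
    have "g y \<in> cvec J" using that gT T by blast
    then show ?thesis using W0(4)[rule_format, OF that] by (auto simp: g1_def cvec_def)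
  qed
  have "g x \<in> T" using x gT by blast
  then obtain W1 f1 where W1: "openin (top_of_set (cvec J)) W1" "g x \<in> W1"
    "\<forall>y\<in>W1. \<forall>j. cdifferentiable J (\<lambda>z. f1 z j) y" "\<forall>y\<in>W1 \<inter> T. f1 y = f y"
    by (rule holo_onE[OF f])
  have "holo_on I W0 g1"
    by (rule holo_onI[where W = "\<lambda>_. W0" and g = "\<lambda>_. g1"]) (use W0(1) W0I g1d in auto)
  then have "continuous_on W0 g1"
    by (rule holo_on_imp_continuous_on[OF I])
  then have "openin (top_of_set W0) (W0 \<inter> g1 -` W1)"
    by (rule continuous_openin_preimage[OF _ _ W1(1)]) (simp add: g1J)
  then have op: "openin (top_of_set (cvec I)) (W0 \<inter> g1 -` W1)"
    using W0(1) by (rule openin_trans)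
  have "x \<in> W0 \<inter> g1 -` W1"
    using W0(2) W1(2) g1g x by simp
  moreover have "cdifferentiable I (\<lambda>z. f1 (g1 z) j) y" if "y \<in> W0 \<inter> g1 -` W1" for y j
    using that W0I by (intro cdifferentiable_compose[OF I _ J g1d g1J] W1(3)[rule_format]) auto
  moreover have "f1 (g1 y) = (f \<circ> g) y" if "y \<in> W0 \<inter> g1 -` W1 \<inter> S" for y
    using that g1g[of y] W1(4)[rule_format, of "g y"] gT by auto
  ultimately show "\<exists>W h. openin (top_of_set (cvec I)) W \<and> x \<in> W \<and>
      (\<forall>y\<in>W. \<forall>j. cdifferentiable I (\<lambda>z. h z j) y) \<and> (\<forall>y\<in>W \<inter> S. h y = (f \<circ> g) y)"
    using op by - (rule exI[of _ "W0 \<inter> g1 -` W1"], rule exI[of _ "\<lambda>z. f1 (g1 z)"], simp)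
qed


section \<open>Quotients by finite free group actions\<close>

text \<open>
  The group is a set of self-maps of \<open>E\<close>; by \<open>fibre\<close> its orbits are the fibres of \<open>F\<close>. The axiom
  \<open>F_open\<close> says that the image of \<open>F\<close> carries the quotient topology.
\<close>

locale finite_free_quotient =
  fixes E :: "'a::metric_space set" and G :: "('a \<Rightarrow> 'a) set" and F :: "'a \<Rightarrow> 'b::metric_space"
  assumes finite_G: "finite G" and id_G: "id \<in> G"
    and G_maps: "g \<in> G \<Longrightarrow> x \<in> E \<Longrightarrow> g x \<in> E"
    and G_continuous: "g \<in> G \<Longrightarrow> continuous_on E g"
    and G_inverse: "g \<in> G \<Longrightarrow> \<exists>h\<in>G. \<forall>x\<in>E. h (g x) = x \<and> g (h x) = x"
    and G_free: "g \<in> G \<Longrightarrow> h \<in> G \<Longrightarrow> x \<in> E \<Longrightarrow> g x = h x \<Longrightarrow> g = h"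
    and fibre: "x \<in> E \<Longrightarrow> y \<in> E \<Longrightarrow> F x = F y \<longleftrightarrow> (\<exists>g\<in>G. y = g x)"
    and F_continuous: "continuous_on E F"
    and F_open: "openin (top_of_set E) U \<Longrightarrow> openin (top_of_set (F ` E)) (F ` U)"
begin

lemma F_G: "g \<in> G \<Longrightarrow> x \<in> E \<Longrightarrow> F (g x) = F x"
  using fibre[of x "g x"] G_maps by auto

text \<open>
  The finitely many points of the orbit of \<open>x\<close> have pairwise distance at least \<open>2 e\<close> for some \<open>e > 0\<close>;
  \<open>U\<close> consists of the points that every group element moves to within \<open>e\<close> of the image of \<open>x\<close>.
\<close>

lemma disjoint_translates:
  assumes x: "x \<in> E"
  obtains U where "openin (top_of_set E) U" "x \<in> U"
    "\<And>g h. g \<in> G \<Longrightarrow> h \<in> G \<Longrightarrow> g \<noteq> h \<Longrightarrow> g ` U \<inter> h ` U = {}"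
proof -
  define D where "D = (\<lambda>(g, h). dist (g x) (h x)) ` {(g, h) \<in> G \<times> G. g \<noteq> h}"
  have "finite {(g, h) \<in> G \<times> G. g \<noteq> h}"
    by (rule finite_subset[of _ "G \<times> G"]) (use finite_G in auto)
  then have finD: "finite D" by (simp add: D_def)
  have "\<forall>\<delta>\<in>D. \<delta> > 0" using G_free x by (auto simp: D_def)
  then have "Min (insert 1 D) > 0" using finD by (subst Min_gr_iff) auto
  define e where "e = Min (insert 1 D) / 2"
  have "Min (insert 1 D) \<le> dist (g x) (h x)" if "g \<in> G" "h \<in> G" "g \<noteq> h" for g h
    using finD that by (intro Min_le) (auto simp: D_def)
  then have e: "e > 0" "\<And>g h. g \<in> G \<Longrightarrow> h \<in> G \<Longrightarrow> g \<noteq> h \<Longrightarrow> dist (g x) (h x) \<ge> 2 * e"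
    using \<open>Min (insert 1 D) > 0\<close> by (auto simp: e_def)
  define U where "U = E \<inter> (\<Inter>g\<in>G. E \<inter> g -` ball (g x) e)"
  have "openin (top_of_set E) (E \<inter> g -` ball (g x) e)" if "g \<in> G" for g
    using G_continuous[OF that] by (intro continuous_openin_preimage_gen) auto
  then have "openin (top_of_set E) U"
    unfolding U_def using finite_G by (intro openin_Int_Inter) auto
  moreover have "x \<in> U" using x e(1) by (auto simp: U_def)
  moreover have "g ` U \<inter> h ` U = {}" if gh: "g \<in> G" "h \<in> G" "g \<noteq> h" for g h
  proof (rule ccontr)
    assume "\<not> ?thesis"
    then obtain u v where uv: "u \<in> U" "v \<in> U" "g u = h v" by blast
    have near: "dist (k x) (k w) < e" if "w \<in> U" "k \<in> G" for k w
      using that unfolding U_def mem_ball[symmetric] by blast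
    have "dist (g x) (h x) < 2 * e"
      using near[OF uv(1) gh(1)] near[OF uv(2) gh(2)] dist_triangle2[of "g x" "h x" "g u"] uv(3)
      by simp
    with e(2)[OF gh] show False by simp
  qed
  ultimately show ?thesis by (rule that)
qed

lemma openin_translate:
  assumes "g \<in> G" "openin (top_of_set E) U"
  shows "openin (top_of_set E) (g ` U)"
proof -
  from G_inverse[OF assms(1)] obtain h where h: "h \<in> G" "\<forall>x\<in>E. h (g x) = x \<and> g (h x) = x" by blast
  have U: "U \<subseteq> E" using assms(2) by (rule openin_imp_subset)
  have "g ` U = E \<inter> h -` U"
    using h U G_maps[OF assms(1)] by (force simp: image_iff)
  then show ?thesis
    using continuous_openin_preimage[OF G_continuous[OF h(1)] _ assms(2)] G_maps[OF h(1)] by auto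
qed

lemma local_homeomorphism:
  assumes U: "openin (top_of_set E) U" and g: "g \<in> G"
    and disj: "\<And>g h. g \<in> G \<Longrightarrow> h \<in> G \<Longrightarrow> g \<noteq> h \<Longrightarrow> g ` U \<inter> h ` U = {}"
  shows "\<exists>q. homeomorphism (g ` U) (F ` U) F q"
proof -
  have UE: "U \<subseteq> E" using U by (rule openin_imp_subset)
  have gU: "openin (top_of_set E) (g ` U)" by (rule openin_translate[OF g U])
  then have gUE: "g ` U \<subseteq> E" by (rule openin_imp_subset)
  have im: "F ` g ` U = F ` U"
    using F_G[OF g] UE by (force simp: image_image)
  have "inj_on F (g ` U)"
  proof (rule inj_onI; clarify)
    fix u v assume uv: "u \<in> U" "v \<in> U" "F (g u) = F (g v)"
    then have "F u = F v" using F_G[OF g] UE by (metis subsetD)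
    then obtain k where "k \<in> G" "v = k u" using fibre uv UE by blast
    with disj[OF id_G, of k] uv show "g u = g v" by (cases "k = id") auto
  qed
  moreover have "openin (top_of_set (F ` U)) (F ` W)" if "openin (top_of_set (g ` U)) W" for W
  proof -
    have "openin (top_of_set (F ` E)) (F ` W)"
      by (rule F_open[OF openin_trans[OF that gU]])
    moreover have "F ` W \<subseteq> F ` U" using image_mono[OF openin_imp_subset[OF that], of F] im by simp
    ultimately show ?thesis using image_mono[OF UE] by (rule openin_subset_trans)
  qed
  ultimately show ?thesis
    using homeomorphism_injective_open_map[of "g ` U" F "F ` U"]
      continuous_on_subset[OF F_continuous gUE] im by metis
qed

lemma covering_space_F: "covering_space E F (F ` E)"
  unfolding covering_space_def
proof (intro conjI ballI)
  fix y assume "y \<in> F ` E"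
  then obtain x where x: "x \<in> E" "y = F x" by blast
  from disjoint_translates[OF x(1)] obtain U where U: "openin (top_of_set E) U" "x \<in> U"
    and disj: "\<And>g h. g \<in> G \<Longrightarrow> h \<in> G \<Longrightarrow> g \<noteq> h \<Longrightarrow> g ` U \<inter> h ` U = {}" by blast
  have UE: "U \<subseteq> E" using U(1) by (rule openin_imp_subset)
  let ?v = "(\<lambda>g. g ` U) ` G"
  have "\<Union>?v = E \<inter> F -` (F ` U)"
  proof (intro set_eqI iffI)
    fix z assume "z \<in> \<Union>?v"
    then show "z \<in> E \<inter> F -` (F ` U)" using UE G_maps F_G by blast
  next
    fix z assume z: "z \<in> E \<inter> F -` (F ` U)"
    then obtain u where "u \<in> U" "F u = F z" by auto
    then show "z \<in> \<Union>?v" using fibre[of u z] UE z by blast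
  qed
  moreover have "pairwise disjnt ?v"
    using disj by (auto simp: pairwise_def disjnt_def)
  ultimately show "\<exists>T. y \<in> T \<and> openin (top_of_set (F ` E)) T \<and>
      (\<exists>v. \<Union>v = E \<inter> F -` T \<and> (\<forall>u\<in>v. openin (top_of_set E) u) \<and> pairwise disjnt v \<and>
        (\<forall>u\<in>v. \<exists>q. homeomorphism u T F q))"
    using x U F_open openin_translate local_homeomorphism[OF U(1) _ disj]
    by (intro exI[of _ "F ` U"] exI[of _ ?v] conjI) auto
qed (auto intro: F_continuous)

lemma finite_sheeted_F: "finite_sheeted E F (F ` E)"
  unfolding finite_sheeted_def
proof (intro exI ballI)
  fix y assume "y \<in> F ` E"
  then obtain x where x: "x \<in> E" "y = F x" by blast
  have "{z \<in> E. F z = y} = (\<lambda>g. g x) ` G"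
  proof (intro set_eqI iffI)
    fix z assume "z \<in> {z \<in> E. F z = y}"
    then show "z \<in> (\<lambda>g. g x) ` G" using fibre[OF x(1), of z] x(2) by auto
  qed (use x F_G G_maps in auto)
  moreover have "inj_on (\<lambda>g. g x) G"
    using G_free x by (auto intro: inj_onI)
  ultimately show "finite {z \<in> E. F z = y} \<and> card {z \<in> E. F z = y} = card G"
    using finite_G by (simp add: card_image)
qed

text \<open>
  At each point a lift \<open>h\<close> of \<open>F\<close> agrees with some group element. If \<open>h x = g x\<close>, then by freeness
  \<open>h x \<noteq> k x\<close> for all other \<open>k\<close>; this persists nearby and leaves only \<open>g\<close>. The product \<open>s\<close> of
  distances expresses these finitely many conditions as the nonvanishing of one continuous function.
\<close>

lemma lift_locally_in_G:
  assumes W: "W \<subseteq> E" and h: "continuous_on W h" "\<And>x. x \<in> W \<Longrightarrow> h x \<in> E \<and> F (h x) = F x"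
    and x: "x \<in> W"
  obtains U g where "openin (top_of_set W) U" "x \<in> U" "g \<in> G" "\<And>y. y \<in> U \<Longrightarrow> h y = g y"
proof -
  have hG: "\<exists>g\<in>G. h y = g y" if "y \<in> W" for y
    using fibre[of y "h y"] h(2)[OF that] W that by auto
  then obtain g where g: "g \<in> G" "h x = g x" using x by blast
  define s where "s = (\<lambda>y. \<Prod>k\<in>G - {g}. dist (h y) (k y))"
  have "continuous_on W s"
    unfolding s_def
    using continuous_on_subset[OF G_continuous W] h(1) by (intro continuous_intros) auto
  then have "openin (top_of_set W) (W \<inter> s -` (- {0}))"
    by (intro continuous_openin_preimage_gen) auto
  moreover have s0: "s y \<noteq> 0 \<longleftrightarrow> (\<forall>k\<in>G - {g}. h y \<noteq> k y)" for y
    unfolding s_def using finite_G by simp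
  have "s x \<noteq> 0" unfolding s0 using g G_free[of g _ x] x W by auto
  moreover have "h y = g y" if "y \<in> W \<inter> s -` (- {0})" for y
    using that hG[of y] s0[of y] by auto
  ultimately show ?thesis using g x by (intro that[of "W \<inter> s -` (- {0})" g]) auto
qed

end


section \<open>The complex structure on the quotient\<close>

lemma homeomorphism_inv_into:
  assumes "homeomorphism U V \<phi> \<psi>"
  shows "homeomorphism U V \<phi> (inv_into U \<phi>)" "\<And>y. y \<in> V \<Longrightarrow> inv_into U \<phi> y = \<psi> y"
proof -
  have "inj_on \<phi> U" using assms by (metis homeomorphism_apply1 inj_on_inverseI)
  then show *: "inv_into U \<phi> y = \<psi> y" if "y \<in> V" for y
    using assms that by (metis homeomorphism_def image_eqI inv_into_f_eq)
  show "homeomorphism U V \<phi> (inv_into U \<phi>)"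
    by (rule homeomorphism_cong[OF assms]) (auto simp: *)
qed

text \<open>
  The total space is covered by one chart \<open>\<Phi>\<close> with inverse \<open>\<Psi>\<close>, and the group acts by holomorphic
  maps.
\<close>

locale finite_free_holomorphic_quotient = finite_free_quotient E G F
  for E :: "('i::countable \<Rightarrow> complex) set" and G and F :: "('i \<Rightarrow> complex) \<Rightarrow> ('j::countable \<Rightarrow> complex)" +
  fixes I :: "'i set" and m :: nat and \<Phi> :: "('i \<Rightarrow> complex) \<Rightarrow> nat \<Rightarrow> complex" and \<Psi>
  assumes finite_I: "finite I"
    and G_holo: "g \<in> G \<Longrightarrow> holo_on I E g"
    and Phi_holo: "holo_on I E \<Phi>"
    and Psi_holo: "holo_on {..<m} (\<Phi> ` E) \<Psi>"
    and Psi_Phi: "x \<in> E \<Longrightarrow> \<Psi> (\<Phi> x) = x"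
    and Phi_open: "openin (top_of_set (cvec {..<m})) (\<Phi> ` E)"
begin

lemma E_cvec: "E \<subseteq> cvec I"
  using Phi_holo by (simp add: holo_on_def)

lemma homeomorphism_Phi: "homeomorphism E (\<Phi> ` E) \<Phi> \<Psi>"
  using holo_on_imp_continuous_on[OF finite_I Phi_holo]
    holo_on_imp_continuous_on[OF finite_lessThan Psi_holo] Psi_Phi
  by (intro homeomorphismI) auto

lemma lift_holo:
  assumes W: "W \<subseteq> E" and h: "continuous_on W h" "\<And>x. x \<in> W \<Longrightarrow> h x \<in> E \<and> F (h x) = F x"
  shows "holo_on I W h"
proof (rule holo_on_local)
  fix x assume "x \<in> W"
  from lift_locally_in_G[OF W h this] obtain U g where
    U: "openin (top_of_set W) U" "x \<in> U" "g \<in> G" "\<And>y. y \<in> U \<Longrightarrow> h y = g y" by metis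
  have "holo_on I U g"
    using holo_on_subset[OF G_holo[OF U(3)]] openin_imp_subset[OF U(1)] W by blast
  then have "holo_on I U h" using holo_on_cong[of U h g] U(4) by simp
  with U show "\<exists>U. openin (top_of_set W) U \<and> x \<in> U \<and> holo_on I U h" by blast
qed (use W E_cvec in blast)

text \<open>
  The inverse \<open>q\<close> of \<open>F\<close> on a sheet, followed by the chart of \<open>E\<close>, is a chart of the quotient.
\<close>

definition sheet_charts :: "('j \<Rightarrow> complex) chart set" where
  "sheet_charts = {(V, \<Phi> \<circ> q) | U V q.
     openin (top_of_set E) U \<and> openin (top_of_set (F ` E)) V \<and> homeomorphism U V F q}"

abbreviation "E_charts \<equiv> submanifold_charts I m E"

lemma complex_manifold_E: "complex_manifold m E E_charts"
  unfolding complex_manifold_def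
proof (intro conjI ballI)
  have "complex_chart m E (E, \<Phi>)"
    unfolding complex_chart_def using Phi_open homeomorphism_inv_into(1)[OF homeomorphism_Phi] by auto
  moreover have "holo_on {..<m} (\<Phi> ` E) (inv_into E \<Phi>)"
    using holo_on_cong[of "\<Phi> ` E" "inv_into E \<Phi>" \<Psi>] homeomorphism_inv_into(2)[OF homeomorphism_Phi]
      Psi_holo by simp
  ultimately have "(E, \<Phi>) \<in> E_charts"
    using Phi_holo by (simp add: submanifold_charts_def)
  moreover have "fst c \<subseteq> E" if "c \<in> E_charts" for c
    using that by (auto simp: submanifold_charts_def complex_chart_def dest!: openin_imp_subset)
  ultimately show "(\<Union>c\<in>E_charts. fst c) = E" by force
next
  fix c assume c: "c \<in> E_charts"
  then show "complex_chart m E c" by (auto simp: submanifold_charts_def)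
  show "case c of (U, \<phi>) \<Rightarrow> \<forall>(V, \<psi>)\<in>E_charts. holo_on {..<m} (\<phi> ` (U \<inter> V)) (\<psi> \<circ> inv_into U \<phi>)"
  proof (clarify)
    fix U \<phi> V \<psi> assume c: "c = (U, \<phi>)" and V: "(V, \<psi>) \<in> E_charts"
    with \<open>c \<in> E_charts\<close> have U: "(U, \<phi>) \<in> E_charts" by simp
    from U have "homeomorphism U (\<phi> ` U) \<phi> (inv_into U \<phi>)"
      by (simp add: submanifold_charts_def complex_chart_def)
    then have "inv_into U \<phi> ` \<phi> ` (U \<inter> V) \<subseteq> V"
      by (auto simp: homeomorphism_def)
    moreover have "holo_on {..<m} (\<phi> ` (U \<inter> V)) (inv_into U \<phi>)" "holo_on I V \<psi>"
      using U V by (auto simp: submanifold_charts_def intro: holo_on_subset)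
    ultimately show "holo_on {..<m} (\<phi> ` (U \<inter> V)) (\<psi> \<circ> inv_into U \<phi>)"
      by (metis holo_on_compose[OF finite_lessThan finite_I])
  qed
qed

lemma sheet_chart_homeomorphism:
  assumes U: "openin (top_of_set E) U" and hom: "homeomorphism U V F q"
  shows "homeomorphism V (\<Phi> ` U) (\<Phi> \<circ> q) (F \<circ> \<Psi>)"
proof -
  have UE: "U \<subseteq> E" using U by (rule openin_imp_subset)
  then have "\<Psi> ` \<Phi> ` U = U" using Psi_Phi by (force simp: image_image)
  then have "homeomorphism U (\<Phi> ` U) \<Phi> \<Psi>"
    using homeomorphism_of_subsets[OF homeomorphism_Phi] UE by blast
  from homeomorphism_compose[OF homeomorphism_symD[OF hom] this] show ?thesis .
qed

lemma F_q:
  assumes "homeomorphism U V F q" "y \<in> V"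
  shows "q y \<in> U" "F (q y) = y"
  using assms by (auto simp: homeomorphism_def)

text \<open>
  In the chart \<open>\<Phi> \<circ> q\<close> a local section \<open>q'\<close> of \<open>F\<close> becomes \<open>(q' \<circ> F) \<circ> \<Psi>\<close>, and \<open>q' \<circ> F\<close> is a lift of
  \<open>F\<close> into \<open>E\<close>, hence holomorphic by \<open>lift_holo\<close>. Taking \<open>q'\<close> from another chart gives the transition
  maps; taking for \<open>q'\<close> an arbitrary local inverse and for \<open>\<psi>\<close> a chart of \<open>E\<close> gives holomorphy of
  the local inverses.
\<close>

lemma sheet_chart_compose_holo:
  assumes U: "openin (top_of_set E) U" and hom: "homeomorphism U V F q"
    and S: "S \<subseteq> V" and q': "continuous_on S q'" "\<And>y. y \<in> S \<Longrightarrow> q' y \<in> T \<and> F (q' y) = y"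
    and T: "T \<subseteq> E" and \<psi>: "holo_on I T \<psi>"
  shows "holo_on {..<m} ((\<Phi> \<circ> q) ` S) (\<psi> \<circ> q' \<circ> inv_into V (\<Phi> \<circ> q))"
proof -
  have UE: "U \<subseteq> E" using U by (rule openin_imp_subset)
  have qS: "q ` S \<subseteq> E" using F_q(1)[OF hom] S UE by blast
  have FqS: "F ` q ` S = S" using F_q(2)[OF hom] S by (force simp: image_image)
  have "continuous_on (q ` S) (q' \<circ> F)"
    using continuous_on_subset[OF F_continuous qS] q'(1) FqS by (intro continuous_on_compose) auto
  then have lift: "holo_on I (q ` S) (q' \<circ> F)"
  proof (rule lift_holo[OF qS])
    fix x assume "x \<in> q ` S"
    then have "F x \<in> S" using FqS by blast
    from q'(2)[OF this] T show "(q' \<circ> F) x \<in> E \<and> F ((q' \<circ> F) x) = F x" by auto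
  qed
  have img: "\<Psi> ` (\<Phi> \<circ> q) ` S \<subseteq> q ` S"
    using Psi_Phi qS by (auto simp: image_subset_iff)
  have "holo_on {..<m} ((\<Phi> \<circ> q) ` S) \<Psi>"
    using qS by (intro holo_on_subset[OF Psi_holo]) auto
  then have "holo_on {..<m} ((\<Phi> \<circ> q) ` S) ((q' \<circ> F) \<circ> \<Psi>)"
    by (rule holo_on_compose[OF finite_lessThan finite_I _ img lift])
  moreover have "((q' \<circ> F) \<circ> \<Psi>) ` (\<Phi> \<circ> q) ` S \<subseteq> T"
  proof clarify
    fix y assume "y \<in> S"
    then have "F (\<Psi> ((\<Phi> \<circ> q) y)) \<in> S" using img FqS by blast
    from q'(2)[OF this] show "((q' \<circ> F) \<circ> \<Psi>) ((\<Phi> \<circ> q) y) \<in> T" by simp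
  qed
  ultimately have "holo_on {..<m} ((\<Phi> \<circ> q) ` S) (\<psi> \<circ> ((q' \<circ> F) \<circ> \<Psi>))"
    using \<psi> by (rule holo_on_compose[OF finite_lessThan finite_I])
  moreover have "(\<psi> \<circ> q' \<circ> inv_into V (\<Phi> \<circ> q)) z = (\<psi> \<circ> ((q' \<circ> F) \<circ> \<Psi>)) z" if "z \<in> (\<Phi> \<circ> q) ` S" for z
  proof -
    have "z \<in> \<Phi> ` U" using that S F_q(1)[OF hom] by auto
    then show ?thesis
      using homeomorphism_inv_into(2)[OF sheet_chart_homeomorphism[OF U hom]] by simp
  qed
  ultimately show ?thesis using holo_on_cong by blast
qed

lemma complex_manifold_quotient: "complex_manifold m (F ` E) sheet_charts"
  unfolding complex_manifold_def
proof (intro conjI ballI)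
  have "\<exists>c\<in>sheet_charts. F x \<in> fst c" if x: "x \<in> E" for x
  proof -
    from disjoint_translates[OF x] obtain U where U: "openin (top_of_set E) U" "x \<in> U"
      and disj: "\<And>g h. g \<in> G \<Longrightarrow> h \<in> G \<Longrightarrow> g \<noteq> h \<Longrightarrow> g ` U \<inter> h ` U = {}" by blast
    obtain q where "homeomorphism U (F ` U) F q"
      using local_homeomorphism[OF U(1) id_G disj] by auto
    then have "(F ` U, \<Phi> \<circ> q) \<in> sheet_charts"
      unfolding sheet_charts_def using U(1) F_open by blast
    then show ?thesis using U(2) by force
  qed
  moreover have "fst c \<subseteq> F ` E" if "c \<in> sheet_charts" for c
    using that by (auto simp: sheet_charts_def dest!: openin_imp_subset)
  ultimately show "(\<Union>c\<in>sheet_charts. fst c) = F ` E" by blast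
next
  fix c assume "c \<in> sheet_charts"
  then obtain U V q where c: "c = (V, \<Phi> \<circ> q)" and U: "openin (top_of_set E) U"
    and V: "openin (top_of_set (F ` E)) V" and hom: "homeomorphism U V F q"
    unfolding sheet_charts_def by blast
  have hom': "homeomorphism V (\<Phi> ` U) (\<Phi> \<circ> q) (F \<circ> \<Psi>)"
    by (rule sheet_chart_homeomorphism[OF U hom])
  have "openin (top_of_set (cvec {..<m})) (\<Phi> ` U)"
    using homeomorphism_imp_open_map[OF homeomorphism_Phi U] Phi_open by (rule openin_trans)
  then show "complex_chart m (F ` E) c"
    unfolding complex_chart_def c
    using V homeomorphism_image1[OF hom'] homeomorphism_inv_into(1)[OF hom'] by simp
  show "case c of (U, \<phi>) \<Rightarrow> \<forall>(V, \<psi>)\<in>sheet_charts. holo_on {..<m} (\<phi> ` (U \<inter> V)) (\<psi> \<circ> inv_into U \<phi>)"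
    unfolding c split_conv
  proof (clarify)
    fix V' \<psi> assume "(V', \<psi>) \<in> sheet_charts"
    then obtain U' q' where \<psi>: "\<psi> = \<Phi> \<circ> q'" and U': "openin (top_of_set E) U'"
      and hom2: "homeomorphism U' V' F q'"
      unfolding sheet_charts_def by blast
    have "continuous_on (V \<inter> V') q'"
      using homeomorphism_cont2[OF hom2] by (rule continuous_on_subset) auto
    then show "holo_on {..<m} ((\<Phi> \<circ> q) ` (V \<inter> V')) (\<psi> \<circ> inv_into V (\<Phi> \<circ> q))"
      unfolding \<psi> using F_q[OF hom2] openin_imp_subset[OF U'] Phi_holo
      by (intro sheet_chart_compose_holo[OF U hom, where T = E]) auto
  qed
qed

lemma holomorphic_map_F: "holomorphic_map m E E_charts (F ` E) sheet_charts F"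
  unfolding holomorphic_map_def
proof (intro conjI; clarify?)
  fix U \<phi> V \<psi> assume U: "(U, \<phi>) \<in> E_charts" and "(V, \<psi>) \<in> sheet_charts"
  then obtain U' q where \<psi>: "\<psi> = \<Phi> \<circ> q" and U': "openin (top_of_set E) U'"
    and hom: "homeomorphism U' V F q"
    unfolding sheet_charts_def by blast
  let ?W = "E \<inter> U \<inter> F -` V"
  have U'E: "U' \<subseteq> E" using U' by (rule openin_imp_subset)
  have "continuous_on ?W (q \<circ> F)"
    by (intro continuous_on_compose continuous_on_subset[OF F_continuous]
        continuous_on_subset[OF homeomorphism_cont2[OF hom]]) auto
  then have lift: "holo_on I ?W (q \<circ> F)"
    using F_q[OF hom] U'E by (intro lift_holo) auto
  have "homeomorphism U (\<phi> ` U) \<phi> (inv_into U \<phi>)"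
    using U by (simp add: submanifold_charts_def complex_chart_def)
  then have img: "inv_into U \<phi> ` \<phi> ` ?W \<subseteq> ?W"
    by (auto simp: homeomorphism_def)
  have "holo_on {..<m} (\<phi> ` ?W) (inv_into U \<phi>)"
    using U by (auto simp: submanifold_charts_def intro: holo_on_subset)
  then have "holo_on {..<m} (\<phi> ` ?W) ((q \<circ> F) \<circ> inv_into U \<phi>)"
    by (rule holo_on_compose[OF finite_lessThan finite_I _ img lift])
  moreover have "((q \<circ> F) \<circ> inv_into U \<phi>) ` \<phi> ` ?W \<subseteq> E"
  proof clarify
    fix y assume "y \<in> E" "y \<in> U" "F y \<in> V"
    then have "F (inv_into U \<phi> (\<phi> y)) \<in> V" using img by blast
    from F_q(1)[OF hom this] U'E show "((q \<circ> F) \<circ> inv_into U \<phi>) (\<phi> y) \<in> E" by auto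
  qed
  ultimately have "holo_on {..<m} (\<phi> ` ?W) (\<Phi> \<circ> ((q \<circ> F) \<circ> inv_into U \<phi>))"
    using Phi_holo by (rule holo_on_compose[OF finite_lessThan finite_I])
  then show "holo_on {..<m} (\<phi> ` ?W) (\<psi> \<circ> F \<circ> inv_into U \<phi>)"
    by (simp add: \<psi> comp_assoc)
qed (auto intro: F_continuous)

lemma holomorphic_map_local_inverse:
  assumes U: "openin (top_of_set E) U" and hom: "homeomorphism U V F q"
  shows "holomorphic_map m V sheet_charts U E_charts q"
  unfolding holomorphic_map_def
proof (intro conjI; clarify?)
  show "continuous_on V q" using hom by (rule homeomorphism_cont2)
  show "\<And>y. y \<in> V \<Longrightarrow> q y \<in> U" using F_q[OF hom] by blast
  fix V' \<psi> U' \<phi> assume "(V', \<psi>) \<in> sheet_charts" and U': "(U', \<phi>) \<in> E_charts"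
  then obtain U'' q'' where \<psi>: "\<psi> = \<Phi> \<circ> q''" and U'': "openin (top_of_set E) U''"
    and hom2: "homeomorphism U'' V' F q''"
    unfolding sheet_charts_def by blast
  have "U' \<subseteq> E" "holo_on I U' \<phi>"
    using U' by (auto simp: submanifold_charts_def complex_chart_def dest: openin_imp_subset)
  then show "holo_on {..<m} (\<psi> ` (V \<inter> V' \<inter> q -` U')) (\<phi> \<circ> q \<circ> inv_into V' \<psi>)"
    unfolding \<psi> using F_q[OF hom]
    by (intro sheet_chart_compose_holo[OF U'' hom2, where T = U']
        continuous_on_subset[OF homeomorphism_cont2[OF hom]]) auto
qed

theorem holomorphic_covering_quotient:
  "holomorphic_covering m E E_charts (F ` E) sheet_charts F"
  unfolding holomorphic_covering_def
  using complex_manifold_E complex_manifold_quotient covering_space_F holomorphic_map_F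
    holomorphic_map_local_inverse by blast

end


section \<open>Partial fractions\<close>

(* Index ranges are written \<open>{1..p}\<close> throughout and should keep this form in the simplifier. *)
declare One_nat_def [simp del]

lemma coprime_linear_powers:
  fixes a b :: complex
  assumes "a \<noteq> b"
  shows "coprime ([:- a, 1:] ^ m) ([:- b, 1:] ^ k)"
proof -
  have "coprime [:- a, 1:] [:- b, 1:]"
  proof (rule coprimeI)
    fix h assume "h dvd [:- a, 1:]" "h dvd [:- b, 1:]"
    then have "h dvd [:- a, 1:] - [:- b, 1:]" by (rule dvd_diff)
    then have "h dvd [:b - a:]" by simp
    moreover have "is_unit [:b - a:]" using assms by (simp add: is_unit_triv)
    ultimately show "is_unit h" by (rule dvd_unit_imp_unit)
  qed
  then show ?thesis by simp
qed

text \<open>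
  Modulo \<open>P k\<close> all summands but the one at \<open>k\<close> vanish, so \<open>P k\<close> divides \<open>A k\<close> times a polynomial
  that is coprime to \<open>P k\<close>, and the degree leaves only \<open>A k = 0\<close>.
\<close>

lemma partial_fraction_unique:
  fixes A P :: "'k \<Rightarrow> complex poly"
  assumes K: "finite K"
    and coprime: "\<And>i j. i \<in> K \<Longrightarrow> j \<in> K \<Longrightarrow> i \<noteq> j \<Longrightarrow> coprime (P i) (P j)"
    and deg: "\<And>k. k \<in> K \<Longrightarrow> degree (A k) < degree (P k)"
    and sum: "(\<Sum>k\<in>K. A k * (\<Prod>j\<in>K - {k}. P j)) = 0"
    and k: "k \<in> K"
  shows "A k = 0"
proof (rule ccontr)
  assume "A k \<noteq> 0"
  have "P k dvd A j * (\<Prod>i\<in>K - {j}. P i)" if "j \<in> K - {k}" for j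
    using that k K by (intro dvd_mult dvd_prodI) auto
  then have "P k dvd (\<Sum>j\<in>K - {k}. A j * (\<Prod>i\<in>K - {j}. P i))"
    by (rule dvd_sum)
  moreover have "A k * (\<Prod>j\<in>K - {k}. P j) = - (\<Sum>j\<in>K - {k}. A j * (\<Prod>i\<in>K - {j}. P i))"
    using sum sum.remove[OF K k, of "\<lambda>k. A k * (\<Prod>j\<in>K - {k}. P j)"]
    by (simp add: eq_neg_iff_add_eq_0)
  ultimately have "P k dvd A k * (\<Prod>j\<in>K - {k}. P j)" by simp
  moreover have "coprime (P k) (\<Prod>j\<in>K - {k}. P j)"
    using k coprime by (intro prod_coprime_right) auto
  ultimately have "P k dvd A k" by (simp add: coprime_dvd_mult_left_iff)
  then have "degree (P k) \<le> degree (A k)" using \<open>A k \<noteq> 0\<close> by (rule dvd_imp_degree_le)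
  with deg[OF k] show False by simp
qed

text \<open>
  One denominator \<open>P k\<close> is split off at a time: a Bezout relation \<open>u * P k + v * M = 1\<close> with the product
  \<open>M\<close> of the others gives \<open>Q = A * M + P k * B\<close>, where \<open>A\<close> is the remainder of \<open>Q * v\<close> modulo
  \<open>P k\<close>, and comparing degrees bounds the degree of \<open>B\<close>. The disjunct \<open>Q = 0\<close> covers the
  empty index set, where no degree is smaller than the empty sum.
\<close>

lemma partial_fraction_exists:
  fixes P :: "'k \<Rightarrow> complex poly" and Q :: "complex poly"
  assumes K: "finite K"
    and coprime: "\<And>i j. i \<in> K \<Longrightarrow> j \<in> K \<Longrightarrow> i \<noteq> j \<Longrightarrow> coprime (P i) (P j)"
    and pos: "\<And>k. k \<in> K \<Longrightarrow> degree (P k) > 0"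
    and deg: "Q = 0 \<or> degree Q < (\<Sum>k\<in>K. degree (P k))"
  shows "\<exists>A. (\<forall>k\<in>K. degree (A k) < degree (P k)) \<and> Q = (\<Sum>k\<in>K. A k * (\<Prod>j\<in>K - {k}. P j))"
  using K coprime pos deg
proof (induction K arbitrary: Q rule: finite_induct)
  case (insert k K)
  define M where "M = (\<Prod>j\<in>K. P j)"
  have nz: "P j \<noteq> 0" if "j \<in> insert k K" for j using insert.prems(2)[OF that] by auto
  have M0: "M \<noteq> 0" unfolding M_def using insert.hyps(1) nz by auto
  have degM: "degree M = (\<Sum>j\<in>K. degree (P j))"
    unfolding M_def using nz by (intro degree_prod_sum_eq) auto
  have "coprime (P k) M"
    unfolding M_def using insert.prems(1) insert.hyps(2) by (intro prod_coprime_right) auto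
  then have "gcd (P k) M = 1" by (rule coprime_imp_gcd_eq_1)
  then obtain u v where uv: "u * P k + v * M = 1"
    using bezout_coefficients_fst_snd[of "P k" M] by metis
  define A where "A = (Q * v) mod P k"
  define B where "B = Q * u + (Q * v) div P k * M"
  have "Q = Q * (u * P k + v * M)" by (simp add: uv)
  also have "\<dots> = Q * u * P k + Q * v * M" by (simp add: algebra_simps)
  also have "Q * v = (Q * v) div P k * P k + A"
    unfolding A_def by (rule div_mult_mod_eq[symmetric])
  finally have Q: "Q = A * M + P k * B" by (simp add: B_def algebra_simps)
  have dA: "degree A < degree (P k)"
    using degree_mod_less[of "P k" "Q * v"] nz[of k] insert.prems(2)[of k] by (auto simp: A_def)
  have "B = 0 \<or> degree B < (\<Sum>j\<in>K. degree (P j))"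
  proof (rule disjCI)
    assume "\<not> degree B < (\<Sum>j\<in>K. degree (P j))"
    then have le: "degree M \<le> degree B" by (simp add: degM)
    show "B = 0"
    proof (rule ccontr)
      assume "B \<noteq> 0"
      then have dPB: "degree (P k * B) = degree (P k) + degree B"
        using nz by (intro degree_mult_eq) auto
      have "degree (A * M) < degree (P k) + degree B"
        using degree_mult_le[of A M] dA le by linarith
      then have "degree Q = degree (P k) + degree B"
        unfolding Q using dPB by (subst degree_add_eq_right) auto
      moreover have "degree Q < degree (P k) + degree M"
        using insert.prems(3) insert.hyps dA \<open>degree Q = _\<close> insert.prems(2)[of k] by (auto simp: degM)
      ultimately show False using le by simp
    qed
  qed
  have "\<exists>C. (\<forall>j\<in>K. degree (C j) < degree (P j)) \<and> B = (\<Sum>j\<in>K. C j * (\<Prod>i\<in>K - {j}. P i))"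
  proof (rule insert.IH)
    show "coprime (P i) (P j)" if "i \<in> K" "j \<in> K" "i \<noteq> j" for i j
      using insert.prems(1) that by simp
    show "degree (P j) > 0" if "j \<in> K" for j using insert.prems(2) that by simp
  qed fact
  then obtain C where
    C: "\<forall>j\<in>K. degree (C j) < degree (P j)" "B = (\<Sum>j\<in>K. C j * (\<Prod>i\<in>K - {j}. P i))"
    by blast
  let ?A = "C(k := A)"
  have "(\<Sum>j\<in>insert k K. ?A j * (\<Prod>i\<in>insert k K - {j}. P i)) =
      A * M + (\<Sum>j\<in>K. C j * (\<Prod>i\<in>insert k K - {j}. P i))"
    using insert.hyps by (auto simp: M_def intro!: sum.cong)
  also have "(\<Sum>j\<in>K. C j * (\<Prod>i\<in>insert k K - {j}. P i)) = P k * B"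
    unfolding C(2) sum_distrib_left
  proof (rule sum.cong[OF refl])
    fix j assume "j \<in> K"
    then have "insert k K - {j} = insert k (K - {j})" using insert.hyps(2) by auto
    then show "C j * (\<Prod>i\<in>insert k K - {j}. P i) = P k * (C j * (\<Prod>i\<in>K - {j}. P i))"
      using insert.hyps by (simp add: mult_ac)
  qed
  finally have "Q = (\<Sum>j\<in>insert k K. ?A j * (\<Prod>i\<in>insert k K - {j}. P i))" using Q by simp
  moreover have "\<forall>j\<in>insert k K. degree (?A j) < degree (P j)" using C(1) dA by simp
  ultimately show ?case by blast
qed simp


section \<open>The polynomials attached to a parameter point\<close>

lemma coeff_mult_top:
  assumes "degree f \<le> a" "degree g \<le> b"
  shows "coeff (f * g) (a + b) = coeff f a * coeff g b"
proof (cases "degree f = a \<and> degree g = b")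
  case True
  then show ?thesis using coeff_mult_degree_sum[of f g] by simp
next
  case False
  then have *: "degree f < a \<or> degree g < b" using assms by linarith
  then have "degree (f * g) < a + b" using assms degree_mult_le[of f g] by linarith
  with * show ?thesis by (elim disjE) (simp_all add: coeff_eq_0)
qed

lemma pcompose_power: "pcompose (f ^ i) g = pcompose f g ^ i"
  for f g :: "'a::comm_ring_1 poly"
  by (induction i) (simp_all add: pcompose_1 pcompose_mult)

lemma pcompose_shift_inverse: "pcompose (pcompose f [:a, 1:]) [:- a, 1:] = f"
  for f :: "complex poly"
  by (simp add: pcompose_assoc[symmetric] pcompose_pCons)

text \<open>
  The numerator over the common denominator \<open>(z - \<zeta>\<^sub>k)\<close> to the power \<open>n k\<close> of the terms of the partial
  fractions decomposition at \<open>\<zeta>\<^sub>k\<close>.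
\<close>

definition principal_part :: "(nat \<Rightarrow> nat) \<Rightarrow> (param_index \<Rightarrow> complex) \<Rightarrow> nat \<Rightarrow> complex poly" where
  "principal_part n x k =
     (\<Sum>i=0..n k - 1. smult (x (Alpha k (n k - i))) ([:- x (Zeta k), 1:] ^ i))"

definition cofactor :: "nat \<Rightarrow> (nat \<Rightarrow> nat) \<Rightarrow> (param_index \<Rightarrow> complex) \<Rightarrow> nat \<Rightarrow> complex poly" where
  "cofactor p n x k = (\<Prod>j\<in>{1..p} - {k}. [:- x (Zeta j), 1:] ^ n j)"

lemma Q_poly_eq: "Q_poly p n x = (\<Sum>k=1..p. principal_part n x k * cofactor p n x k)"
  by (simp add: Q_poly_def principal_part_def cofactor_def)

lemma P_hat_split: "k \<in> {1..p} \<Longrightarrow> P_hat p n x = [:- x (Zeta k), 1:] ^ n k * cofactor p n x k"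
  unfolding P_hat_def cofactor_def by (intro prod.remove) auto

text \<open>
  After the shift \<open>z \<mapsto> z + \<zeta>\<^sub>k\<close> the parameters are read off as coefficients, which makes them
  functions of the principal part and provides the principal part with any prescribed Taylor
  polynomial.
\<close>

lemma coeff_pcompose_principal_part:
  "coeff (pcompose (principal_part n x k) [:x (Zeta k), 1:]) i =
    (if i \<le> n k - 1 then x (Alpha k (n k - i)) else 0)"
proof -
  have "pcompose [:- x (Zeta k), 1:] [:x (Zeta k), 1:] = monom 1 1"
    by (simp add: pcompose_pCons monom_altdef)
  then have "pcompose (principal_part n x k) [:x (Zeta k), 1:] =
      (\<Sum>i=0..n k - 1. monom (x (Alpha k (n k - i))) i)"
    by (simp add: principal_part_def pcompose_sum pcompose_smult pcompose_power monom_power smult_monom)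
  then show ?thesis
    by (simp add: coeff_sum)
qed

lemma principal_part_eqD:
  assumes "principal_part n x k = principal_part n y k" "x (Zeta k) = y (Zeta k)" "l \<in> {1..n k}"
  shows "x (Alpha k l) = y (Alpha k l)"
proof -
  have "n k - l \<le> n k - 1" "n k - (n k - l) = l" using assms(3) by auto
  then show ?thesis
    using coeff_pcompose_principal_part[of n x k "n k - l"]
      coeff_pcompose_principal_part[of n y k "n k - l"] assms(1,2) by simp
qed

lemma poly_principal_part: "poly (principal_part n x k) (x (Zeta k)) = x (Alpha k (n k))"
  using coeff_pcompose_principal_part[of n x k 0]
  by (simp add: poly_0_coeff_0[symmetric] poly_pcompose)

lemma principal_part_ex:
  assumes "degree A < n k" "\<And>i. i < n k \<Longrightarrow> x (Alpha k (n k - i)) = coeff (pcompose A [:x (Zeta k), 1:]) i"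
  shows "principal_part n x k = A"
proof -
  have "pcompose (principal_part n x k) [:x (Zeta k), 1:] = pcompose A [:x (Zeta k), 1:]"
  proof (rule poly_eqI)
    fix i
    have "degree (pcompose A [:x (Zeta k), 1:]) = degree A" by (simp add: degree_pcompose)
    then show "coeff (pcompose (principal_part n x k) [:x (Zeta k), 1:]) i =
        coeff (pcompose A [:x (Zeta k), 1:]) i"
      using assms by (auto simp: coeff_pcompose_principal_part coeff_eq_0)
  qed
  then show ?thesis by (metis pcompose_shift_inverse)
qed

lemma degree_principal_part: "degree (principal_part n x k) \<le> n k - 1"
  unfolding principal_part_def
proof (intro degree_sum_le)
  fix i assume "i \<in> {0..n k - 1}"
  then show "degree (smult (x (Alpha k (n k - i))) ([:- x (Zeta k), 1:] ^ i)) \<le> n k - 1"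
    using degree_smult_le[of "x (Alpha k (n k - i))" "[:- x (Zeta k), 1:] ^ i"]
    by (simp add: degree_linear_power)
qed simp

lemma coeff_principal_part_top:
  assumes "n k > 0"
  shows "coeff (principal_part n x k) (n k - 1) = x (Alpha k 1)"
proof -
  have "coeff ([:- x (Zeta k), 1:] ^ i) (n k - 1) = (if i = n k - 1 then 1 else 0)"
    if "i \<le> n k - 1" for i
    using that coeff_linear_power[of "- x (Zeta k)" i] by (auto intro!: coeff_eq_0 simp: degree_linear_power)
  then have "coeff (principal_part n x k) (n k - 1) =
      (\<Sum>i=0..n k - 1. if i = n k - 1 then x (Alpha k (n k - i)) else 0)"
    unfolding principal_part_def coeff_sum by (intro sum.cong) auto
  then show ?thesis using assms by (simp add: Suc_leI)
qed

lemma degree_prod_linear_powers: "degree (\<Prod>j\<in>K. [:- f j, 1:] ^ n j) = (\<Sum>j\<in>K. n j)"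
  for f :: "'k \<Rightarrow> complex"
proof -
  have "degree (\<Prod>j\<in>K. [:- f j, 1:] ^ n j) = (\<Sum>j\<in>K. degree ([:- f j, 1:] ^ n j))"
    by (rule degree_prod_sum_eq) simp
  then show ?thesis by (simp add: degree_linear_power)
qed

lemma monic_prod_linear_powers: "lead_coeff (\<Prod>j\<in>K. [:- f j, 1:] ^ n j) = 1"
  for f :: "'k \<Rightarrow> complex"
  by (simp only: lead_coeff_prod lead_coeff_power) simp


locale overlap_data =
  fixes d p :: nat and n :: "nat \<Rightarrow> nat"
  assumes n_pos: "k \<in> {1..p} \<Longrightarrow> n k > 0"
    and n_sum: "(\<Sum>k=1..p. n k) = d + 1"
begin

abbreviation "E \<equiv> E_tilde p n"
abbreviation "I \<equiv> param_indices p n"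

lemma finite_I: "finite I"
proof -
  have "{Alpha k l |k l. k \<in> {1..p} \<and> l \<in> {1..n k}} = (\<lambda>(k, l). Alpha k l) ` (SIGMA k:{1..p}. {1..n k})"
    by auto
  then show ?thesis by (simp add: param_indices_def)
qed

lemma param_indices_simps [simp]:
  "Zeta k \<in> I \<longleftrightarrow> k \<in> {1..p}" "Alpha k l \<in> I \<longleftrightarrow> k \<in> {1..p} \<and> l \<in> {1..n k}"
  by (auto simp: param_indices_def)

lemma E_cvec: "E \<subseteq> cvec I"
  by (auto simp: E_tilde_def)

lemma degree_P_hat: "degree (P_hat p n x) = d + 1"
  by (simp add: P_hat_def degree_prod_linear_powers n_sum)

lemma coeff_P_hat_top: "coeff (P_hat p n x) (d + 1) = 1"
  using monic_prod_linear_powers[of "\<lambda>j. x (Zeta j)" n "{1..p}"] degree_P_hat[of x]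
  by (simp add: P_hat_def)

lemma degree_cofactor: "k \<in> {1..p} \<Longrightarrow> degree (cofactor p n x k) = d + 1 - n k"
  by (simp add: cofactor_def degree_prod_linear_powers sum_diff1_nat n_sum)

lemma n_le: "k \<in> {1..p} \<Longrightarrow> n k \<le> d + 1"
  using member_le_sum[of k "{1..p}" n] n_sum by simp

lemma degree_Q_poly: "degree (Q_poly p n x) \<le> d"
  unfolding Q_poly_eq
proof (intro degree_sum_le)
  fix k assume k: "k \<in> {1..p}"
  show "degree (principal_part n x k * cofactor p n x k) \<le> d"
    using degree_mult_le[of "principal_part n x k" "cofactor p n x k"] degree_principal_part[of n x k]
      degree_cofactor[OF k, of x] n_pos[OF k] n_le[OF k] by linarith
qed simp

lemma coeff_Q_poly_top: "coeff (Q_poly p n x) d = (\<Sum>k=1..p. x (Alpha k 1))"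
  unfolding Q_poly_eq coeff_sum
proof (rule sum.cong[OF refl])
  fix k assume k: "k \<in> {1..p}"
  have "coeff (principal_part n x k * cofactor p n x k) ((n k - 1) + (d + 1 - n k)) =
      coeff (principal_part n x k) (n k - 1) * coeff (cofactor p n x k) (d + 1 - n k)"
    using degree_principal_part degree_cofactor[OF k, of x] by (intro coeff_mult_top) auto
  moreover have "coeff (cofactor p n x k) (d + 1 - n k) = 1"
    using monic_prod_linear_powers[of "\<lambda>j. x (Zeta j)" n "{1..p} - {k}"] degree_cofactor[OF k, of x]
    by (simp add: cofactor_def)
  moreover have "(n k - 1) + (d + 1 - n k) = d" using n_pos[OF k] n_le[OF k] by simp
  ultimately show "coeff (principal_part n x k * cofactor p n x k) d = x (Alpha k 1)"
    using coeff_principal_part_top[of n k x] n_pos[OF k] by simp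
qed

lemma poly_P_hat_eq_0_iff: "poly (P_hat p n x) z = 0 \<longleftrightarrow> (\<exists>k\<in>{1..p}. z = x (Zeta k))"
  using n_pos by (auto simp: P_hat_def poly_prod poly_power)

lemma poly_P_hat_Zeta: "k \<in> {1..p} \<Longrightarrow> poly (P_hat p n x) (x (Zeta k)) = 0"
  unfolding poly_P_hat_eq_0_iff by blast

lemma P_hat_zeros: "{z. poly (P_hat p n x) z = 0} = (\<lambda>k. x (Zeta k)) ` {1..p}"
  by (auto simp: poly_P_hat_eq_0_iff)

lemma poly_cofactor_neq_0:
  assumes "inj_on (\<lambda>k. x (Zeta k)) {1..p}" "k \<in> {1..p}"
  shows "poly (cofactor p n x k) (x (Zeta k)) \<noteq> 0"
  using assms by (auto simp: cofactor_def poly_prod poly_power dest: inj_onD)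

lemma poly_Q_poly:
  assumes k: "k \<in> {1..p}"
  shows "poly (Q_poly p n x) (x (Zeta k)) = x (Alpha k (n k)) * poly (cofactor p n x k) (x (Zeta k))"
proof -
  have "poly (cofactor p n x j) (x (Zeta k)) = 0" if "j \<in> {1..p} - {k}" for j
    using that k n_pos by (auto simp: cofactor_def poly_prod poly_power)
  then have "(\<Sum>j\<in>{1..p} - {k}. poly (principal_part n x j * cofactor p n x j) (x (Zeta k))) = 0"
    by (intro sum.neutral) auto
  then show ?thesis
    unfolding Q_poly_eq poly_sum using k
    by (subst sum.remove[of _ k]) (auto simp: poly_principal_part)
qed

lemma order_P_hat:
  assumes "inj_on (\<lambda>k. x (Zeta k)) {1..p}" "k \<in> {1..p}"
  shows "order (x (Zeta k)) (P_hat p n x) = n k"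
proof -
  have "cofactor p n x k \<noteq> 0" using poly_cofactor_neq_0[OF assms] by auto
  then show ?thesis
    using poly_cofactor_neq_0[OF assms]
    by (simp add: P_hat_split[OF assms(2)] order_mult order_power_n_n order_0I)
qed

lemma zero_multiplicities_P_hat:
  assumes inj: "inj_on (\<lambda>k. x (Zeta k)) {1..p}"
  shows "zero_multiplicities (P_hat p n x) = image_mset n (mset_set {1..p})"
proof -
  have "zero_multiplicities (P_hat p n x) =
      image_mset (\<lambda>z. order z (P_hat p n x)) (image_mset (\<lambda>k. x (Zeta k)) (mset_set {1..p}))"
    by (simp add: zero_multiplicities_def image_mset_mset_set[OF inj] P_hat_zeros)
  also have "\<dots> = image_mset n (mset_set {1..p})"
    unfolding image_mset.compositionality
    by (intro image_mset_cong) (simp add: order_P_hat[OF inj])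
  finally show ?thesis .
qed

abbreviation P_poly :: "(param_index \<Rightarrow> complex) \<Rightarrow> complex poly" where
  "P_poly x \<equiv> [:0, 1:] * Q_poly p n x - P_hat p n x"

lemma E_inj: "x \<in> E \<Longrightarrow> inj_on (\<lambda>k. x (Zeta k)) {1..p}"
  by (simp add: E_tilde_def)

lemma canonical_rep_fixed_points:
  assumes "degree Q = d" "lead_coeff Q = 1" "degree F = d + 1" "coeff F (d + 1) = 1"
    and no_common_zero: "\<And>z. poly F z = 0 \<Longrightarrow> poly Q z \<noteq> 0"
  shows "canonical_rep d (Fract ([:0, 1:] * Q - F) Q) ([:0, 1:] * Q - F) Q"
proof -
  have "degree ([:0, 1:] * Q - F) \<le> d"
  proof (rule degree_le; intro allI impI)
    fix i assume "d < i"
    then consider "i = d + 1" | "i > d + 1" by linarith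
    then show "coeff ([:0, 1:] * Q - F) i = 0"
      using assms by cases (auto simp: coeff_pCons coeff_eq_0 split: nat.splits)
  qed
  then show ?thesis
    using assms no_common_zero unfolding canonical_rep_def by auto
qed

lemma canonical_rep_Pi_proj:
  assumes x: "x \<in> E"
  shows "canonical_rep d (Pi_proj p n x) (P_poly x) (Q_poly p n x)"
proof -
  have top: "coeff (Q_poly p n x) d = 1" using x coeff_Q_poly_top by (simp add: E_tilde_def)
  then have deg: "degree (Q_poly p n x) = d" using degree_Q_poly[of x] le_degree[of "Q_poly p n x" d]
    by simp
  have "Q_poly p n x \<noteq> 0" using top by auto
  then have "Pi_proj p n x = Fract (P_poly x) (Q_poly p n x)"
    by (simp add: Pi_proj_def)
  moreover have "poly (Q_poly p n x) z \<noteq> 0" if "poly (P_hat p n x) z = 0" for z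
    using that x poly_Q_poly[of _ x] poly_cofactor_neq_0[OF E_inj[OF x]]
    by (auto simp: poly_P_hat_eq_0_iff E_tilde_def)
  ultimately show ?thesis
    using canonical_rep_fixed_points[OF deg _ degree_P_hat coeff_P_hat_top[of x]] top deg by simp
qed

lemma coeff_params_eq: "canonical_rep d R P Q \<Longrightarrow> coeff_params d R = coeff_vector d P Q"
  unfolding coeff_params_def
  by (rule the_equality) (auto dest: canonical_rep_unique)

lemma overlap_type_eq:
  "canonical_rep d R P Q \<Longrightarrow> overlap_type d R = zero_multiplicities ([:0, 1:] * Q - P)"
  unfolding overlap_type_def
  by (rule the_equality) (auto dest: canonical_rep_unique)

lemma Pi_proj_in_overlap_class:
  assumes "x \<in> E"
  shows "Pi_proj p n x \<in> overlap_class d p n"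
  using canonical_rep_Pi_proj[OF assms] overlap_type_eq[OF canonical_rep_Pi_proj[OF assms]]
    zero_multiplicities_P_hat[OF E_inj[OF assms]]
  by (auto simp: overlap_class_def canonical_family_def)

text \<open>
  Any enumeration of the zeros can be corrected by a permutation so that the multiplicities appear in
  the prescribed order, since both lists of multiplicities are the same multiset.
\<close>

lemma distinct_zeros_labelling:
  assumes F: "F \<noteq> 0" and zm: "zero_multiplicities F = image_mset n (mset_set {1..p})"
  obtains \<zeta> where "bij_betw \<zeta> {1..p} {z. poly F z = 0}" "\<And>k. k \<in> {1..p} \<Longrightarrow> order (\<zeta> k) F = n k"
proof -
  let ?Z = "{z. poly F z = 0}"
  have fin: "finite ?Z" using F by (rule poly_roots_finite)
  have "size (zero_multiplicities F) = p" unfolding zm by simp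
  then have "card ?Z = card {1..p}" by (simp add: zero_multiplicities_def)
  then obtain e where e: "bij_betw e {1..p} ?Z"
    using fin by (metis finite_same_card_bij finite_atLeastAtMost)
  have "zero_multiplicities F = image_mset (\<lambda>z. order z F) (image_mset e (mset_set {1..p}))"
    using e by (simp add: zero_multiplicities_def image_mset_mset_set bij_betw_def)
  then have "image_mset n (mset_set {1..p}) = image_mset (\<lambda>k. order (e k) F) (mset_set {1..p})"
    using zm by (simp add: image_mset.compositionality comp_def)
  then obtain \<sigma> where \<sigma>: "\<sigma> permutes {1..p}" "\<forall>k\<in>{1..p}. n k = order (e (\<sigma> k)) F"
    by (rule image_mset_eq_implies_permutes[OF finite_atLeastAtMost]) 
  have "bij_betw (e \<circ> \<sigma>) {1..p} ?Z"
    using permutes_imp_bij[OF \<sigma>(1)] e by (rule bij_betw_trans)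
  with \<sigma>(2) show ?thesis by (intro that[of "e \<circ> \<sigma>"]) auto
qed

text \<open>
  The fixed points, enumerated so that multiplicities match, are the \<open>\<zeta>\<^sub>k\<close>, and the Taylor
  coefficients at \<open>\<zeta>\<^sub>k\<close> of the partial fractions numerators are the \<open>\<alpha>\<^bsub>k,l\<^esub>\<close>. The two
  conditions on the \<open>\<alpha>\<^bsub>k,l\<^esub>\<close> are monicity of \<open>Q\<close> and absence of common zeros.
\<close>

lemma Pi_proj_surj:
  assumes R: "R \<in> overlap_class d p n"
  shows "\<exists>x\<in>E. Pi_proj p n x = R"
proof -
  from R obtain P Q where rep: "canonical_rep d R P Q"
    and type: "overlap_type d R = image_mset n (mset_set {1..p})"
    by (auto simp: overlap_class_def canonical_family_def)
  define F where "F = [:0, 1:] * Q - P"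
  have deg: "degree P \<le> d" "degree Q = d" "coeff Q d = 1" and ncz: "\<And>z. poly P z = 0 \<Longrightarrow> poly Q z \<noteq> 0"
    and RPQ: "R = Fract P Q"
    using rep by (auto simp: canonical_rep_def)
  have Q0: "Q \<noteq> 0" using deg(3) by auto
  have "coeff F (d + 1) = 1" using deg by (simp add: F_def coeff_eq_0 One_nat_def)
  moreover have "degree F \<le> d + 1"
    unfolding F_def using deg(1,2) degree_mult_le[of "[:0, 1:]" Q] by (intro degree_diff_le) auto
  ultimately have dF: "degree F = d + 1" using le_degree[of F "d + 1"] by simp
  then have lF: "lead_coeff F = 1" using \<open>coeff F (d + 1) = 1\<close> by simp
  have F0: "F \<noteq> 0" using lF by auto
  have "zero_multiplicities F = image_mset n (mset_set {1..p})"
    using type overlap_type_eq[OF rep] by (simp add: F_def)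
  from distinct_zeros_labelling[OF F0 this] obtain \<zeta> where
    bij: "bij_betw \<zeta> {1..p} {z. poly F z = 0}" and ord: "\<And>k. k \<in> {1..p} \<Longrightarrow> order (\<zeta> k) F = n k"
    by metis
  have inj: "inj_on \<zeta> {1..p}" using bij by (rule bij_betw_imp_inj_on)
  have F: "F = (\<Prod>j=1..p. [:- \<zeta> j, 1:] ^ n j)"
  proof -
    have "F = (\<Prod>z | poly F z = 0. [:- z, 1:] ^ order z F)"
      using complex_poly_decompose[of F] lF by simp
    also have "\<dots> = (\<Prod>j=1..p. [:- \<zeta> j, 1:] ^ order (\<zeta> j) F)"
      by (rule prod.reindex_bij_betw[OF bij, symmetric])
    also have "\<dots> = (\<Prod>j=1..p. [:- \<zeta> j, 1:] ^ n j)"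
      by (rule prod.cong) (simp_all add: ord)
    finally show ?thesis .
  qed
  have "\<exists>A. (\<forall>k\<in>{1..p}. degree (A k) < degree ([:- \<zeta> k, 1:] ^ n k)) \<and>
      Q = (\<Sum>k=1..p. A k * (\<Prod>j\<in>{1..p} - {k}. [:- \<zeta> j, 1:] ^ n j))"
    using inj n_pos deg(2) n_sum
    by (intro partial_fraction_exists coprime_linear_powers) (auto simp: degree_linear_power dest: inj_onD)
  then obtain A where "\<forall>k\<in>{1..p}. degree (A k) < degree ([:- \<zeta> k, 1:] ^ n k)"
    and QA: "Q = (\<Sum>k=1..p. A k * (\<Prod>j\<in>{1..p} - {k}. [:- \<zeta> j, 1:] ^ n j))"
    by blast
  then have A: "degree (A k) < n k" if "k \<in> {1..p}" for k
    using that by (simp add: degree_linear_power)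
  define x where "x = (\<lambda>i. if i \<in> I then case i of Zeta k \<Rightarrow> \<zeta> k
      | Alpha k l \<Rightarrow> coeff (pcompose (A k) [:\<zeta> k, 1:]) (n k - l) else 0)"
  have x_Zeta: "x (Zeta k) = \<zeta> k" if "k \<in> {1..p}" for k
    using that by (auto simp: x_def param_indices_def)
  have x_Alpha: "x (Alpha k l) = coeff (pcompose (A k) [:\<zeta> k, 1:]) (n k - l)"
    if "k \<in> {1..p}" "l \<in> {1..n k}" for k l
    using that by (auto simp: x_def param_indices_def)
  have pp: "principal_part n x k = A k" if k: "k \<in> {1..p}" for k
  proof (rule principal_part_ex)
    show "degree (A k) < n k" using k by (rule A)
    fix i assume "i < n k"
    then show "x (Alpha k (n k - i)) = coeff (pcompose (A k) [:x (Zeta k), 1:]) i"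
      using x_Alpha[OF k, of "n k - i"] by (simp add: x_Zeta[OF k])
  qed
  have cof: "cofactor p n x k = (\<Prod>j\<in>{1..p} - {k}. [:- \<zeta> j, 1:] ^ n j)" for k
    unfolding cofactor_def by (rule prod.cong) (simp_all add: x_Zeta)
  have Qx: "Q_poly p n x = Q"
    unfolding Q_poly_eq QA by (rule sum.cong) (simp_all add: pp cof)
  have Px: "P_hat p n x = F"
    unfolding P_hat_def F by (rule prod.cong) (simp_all add: x_Zeta)
  have "x (Alpha k (n k)) \<noteq> 0" if k: "k \<in> {1..p}" for k
  proof
    assume "x (Alpha k (n k)) = 0"
    then have "poly Q (\<zeta> k) = 0" using poly_Q_poly[OF k, of x] by (simp add: Qx x_Zeta[OF k])
    moreover have "poly F (\<zeta> k) = 0" using bij k by (auto simp: bij_betw_def)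
    ultimately have "poly P (\<zeta> k) = 0" by (simp add: F_def)
    with ncz \<open>poly Q (\<zeta> k) = 0\<close> show False by blast
  qed
  moreover have "inj_on (\<lambda>k. x (Zeta k)) {1..p}"
    using inj inj_on_cong[of "{1..p}" "\<lambda>k. x (Zeta k)" \<zeta>] x_Zeta by blast
  moreover have "(\<Sum>k=1..p. x (Alpha k 1)) = 1" using coeff_Q_poly_top[of x] deg by (simp add: Qx)
  moreover have "x \<in> cvec I" by (simp add: x_def cvec_def)
  ultimately have "x \<in> E" by (simp add: E_tilde_def)
  moreover have "Pi_proj p n x = R"
    using Q0 by (simp add: Pi_proj_def Qx Px RPQ F_def)
  ultimately show ?thesis by blast
qed

lemma Pi_proj_image: "Pi_proj p n ` E = overlap_class d p n"
  using Pi_proj_in_overlap_class Pi_proj_surj by blast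


section \<open>The fibres of the projection\<close>

definition coeff_map :: "(param_index \<Rightarrow> complex) \<Rightarrow> coeff_index \<Rightarrow> complex" where
  "coeff_map x = coeff_vector d (P_poly x) (Q_poly p n x)"

lemma coeff_params_Pi_proj: "x \<in> E \<Longrightarrow> coeff_params d (Pi_proj p n x) = coeff_map x"
  unfolding coeff_map_def by (rule coeff_params_eq[OF canonical_rep_Pi_proj])

lemma coeff_vector_eqD:
  assumes "canonical_rep d R P Q" "canonical_rep d R' P' Q'" "coeff_vector d P Q = coeff_vector d P' Q'"
  shows "P = P'" "Q = Q'"
proof -
  have *: "degree P \<le> d" "degree P' \<le> d" "degree Q = d" "degree Q' = d" "coeff Q d = 1" "coeff Q' d = 1"
    using assms(1,2) by (auto simp: canonical_rep_def)
  show "P = P'"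
  proof (rule poly_eqI)
    fix i show "coeff P i = coeff P' i"
      using fun_cong[OF assms(3), of "Num_coeff i"] * 
      by (cases "i \<le> d") (auto simp: coeff_vector_def coeff_eq_0)
  qed
  show "Q = Q'"
  proof (rule poly_eqI)
    fix i show "coeff Q i = coeff Q' i"
      using fun_cong[OF assms(3), of "Den_coeff i"] * 
      by (cases "i < d"; cases "i = d") (auto simp: coeff_vector_def coeff_eq_0)
  qed
qed

lemma coeff_map_eqD:
  assumes "x \<in> E" "y \<in> E" "coeff_map x = coeff_map y"
  shows "P_hat p n x = P_hat p n y" "Q_poly p n x = Q_poly p n y"
proof -
  show Q: "Q_poly p n x = Q_poly p n y"
    using coeff_vector_eqD(2)[OF canonical_rep_Pi_proj canonical_rep_Pi_proj] assms
    by (simp add: coeff_map_def)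
  have "P_poly x = P_poly y"
    using coeff_vector_eqD(1)[OF canonical_rep_Pi_proj canonical_rep_Pi_proj] assms
    by (simp add: coeff_map_def)
  with Q show "P_hat p n x = P_hat p n y" by simp
qed

text \<open>
  The points are arbitrary apart from the distinctness of the zeros, because the lemma is also applied to
  limits of rescaled points, where the coefficients \<open>x (Alpha k (n k))\<close> may vanish.
\<close>

lemma principal_part_eqI:
  assumes inj: "inj_on (\<lambda>k. x (Zeta k)) {1..p}"
    and zeta: "\<And>k. k \<in> {1..p} \<Longrightarrow> x (Zeta k) = y (Zeta k)"
    and Q: "Q_poly p n x = Q_poly p n y"
    and k: "k \<in> {1..p}"
  shows "principal_part n x k = principal_part n y k"
proof -
  let ?P = "\<lambda>k. [:- x (Zeta k), 1:] ^ n k"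
  have cof: "cofactor p n y k = (\<Prod>j\<in>{1..p} - {k}. ?P j)" for k
    unfolding cofactor_def by (rule prod.cong) (simp_all add: zeta)
  have "principal_part n x k - principal_part n y k = 0"
  proof (rule partial_fraction_unique[of "{1..p}" ?P])
    show "coprime (?P i) (?P j)" if "i \<in> {1..p}" "j \<in> {1..p}" "i \<noteq> j" for i j
      using inj that by (intro coprime_linear_powers) (auto dest: inj_onD)
    show "degree (principal_part n x k - principal_part n y k) < degree (?P k)" if "k \<in> {1..p}" for k
      using degree_diff_le[OF degree_principal_part[of n x k] degree_principal_part[of n y k]] n_pos[OF that]
      by (simp add: degree_linear_power)
    show "(\<Sum>k=1..p. (principal_part n x k - principal_part n y k) * (\<Prod>j\<in>{1..p} - {k}. ?P j)) = 0"
      using Q by (simp add: Q_poly_eq cof left_diff_distrib sum_subtractf cofactor_def[of p n x])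
  qed (use k in auto)
  then show ?thesis by simp
qed

lemma cvec_eqI:
  assumes "x \<in> cvec I" "y \<in> cvec I"
    and "\<And>k. k \<in> {1..p} \<Longrightarrow> x (Zeta k) = y (Zeta k)"
    and "\<And>k l. k \<in> {1..p} \<Longrightarrow> l \<in> {1..n k} \<Longrightarrow> x (Alpha k l) = y (Alpha k l)"
  shows "x = y"
proof
  fix i show "x i = y i"
    using assms by (cases "i \<in> I") (auto simp: param_indices_def cvec_def)
qed

lemma E_eqI:
  assumes "x \<in> E" "y \<in> E" "\<And>k. k \<in> {1..p} \<Longrightarrow> x (Zeta k) = y (Zeta k)" "Q_poly p n x = Q_poly p n y"
  shows "x = y"
proof (rule cvec_eqI)
  fix k l assume k: "k \<in> {1..p}" "l \<in> {1..n k}"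
  show "x (Alpha k l) = y (Alpha k l)"
    using principal_part_eqI[OF E_inj[OF assms(1)] assms(3,4) k(1)] assms(3)[OF k(1)] k(2)
    by (rule principal_part_eqD)
qed (use assms E_cvec in auto)

definition relabel :: "(nat \<Rightarrow> nat) \<Rightarrow> (param_index \<Rightarrow> complex) \<Rightarrow> param_index \<Rightarrow> complex" where
  "relabel \<sigma> x = (\<lambda>i. case i of Zeta k \<Rightarrow> x (Zeta (\<sigma> k)) | Alpha k l \<Rightarrow> x (Alpha (\<sigma> k) l))"

definition symmetries :: "(nat \<Rightarrow> nat) set" where
  "symmetries = {\<sigma>. \<sigma> permutes {1..p} \<and> (\<forall>k. n (\<sigma> k) = n k)}"

lemma relabel_simps [simp]:
  "relabel \<sigma> x (Zeta k) = x (Zeta (\<sigma> k))" "relabel \<sigma> x (Alpha k l) = x (Alpha (\<sigma> k) l)"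
  by (simp_all add: relabel_def)

lemma relabel_cvec:
  assumes "\<sigma> \<in> symmetries" "x \<in> cvec I"
  shows "relabel \<sigma> x \<in> cvec I"
  unfolding cvec_def
proof (intro CollectI allI impI)
  fix i assume i: "i \<notin> I"
  have \<sigma>: "\<sigma> permutes {1..p}" "\<And>k. n (\<sigma> k) = n k" using assms(1) by (auto simp: symmetries_def)
  have 0: "x j = 0" if "j \<notin> I" for j using that assms(2) by (simp add: cvec_def)
  show "relabel \<sigma> x i = 0"
    using i by (cases i) (simp_all add: 0 \<sigma>(2) permutes_in_image[OF \<sigma>(1)] del: atLeastAtMost_iff)
qed

lemma relabel_E:
  assumes s: "\<sigma> \<in> symmetries" and x: "x \<in> E"
  shows "relabel \<sigma> x \<in> E"
proof -
  have \<sigma>: "\<sigma> permutes {1..p}" "\<And>k. n (\<sigma> k) = n k" using s by (auto simp: symmetries_def)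
  have "inj_on (\<lambda>k. x (Zeta (\<sigma> k))) {1..p}"
    using comp_inj_on[OF permutes_inj_on[OF \<sigma>(1)], of "\<lambda>k. x (Zeta k)" "{1..p}"] E_inj[OF x]
      permutes_image[OF \<sigma>(1)] by (simp add: comp_def)
  moreover have "(\<Sum>k=1..p. x (Alpha (\<sigma> k) 1)) = (\<Sum>k=1..p. x (Alpha k 1))"
    using sum.permute[OF \<sigma>(1), of "\<lambda>k. x (Alpha k 1)"] by (simp add: comp_def)
  moreover have "x (Alpha (\<sigma> k) (n k)) \<noteq> 0" if "k \<in> {1..p}" for k
  proof -
    have "\<sigma> k \<in> {1..p}" using that permutes_in_image[OF \<sigma>(1), of k] by simp
    then have "x (Alpha (\<sigma> k) (n (\<sigma> k))) \<noteq> 0" using x unfolding E_tilde_def by blast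
    then show ?thesis by (simp add: \<sigma>(2))
  qed
  ultimately show ?thesis
    using x relabel_cvec[OF s, of x] by (simp add: E_tilde_def)
qed

lemma
  assumes s: "\<sigma> \<in> symmetries"
  shows P_hat_relabel: "P_hat p n (relabel \<sigma> x) = P_hat p n x"
    and Q_poly_relabel: "Q_poly p n (relabel \<sigma> x) = Q_poly p n x"
proof -
  have \<sigma>: "\<sigma> permutes {1..p}" "\<And>k. n (\<sigma> k) = n k" using s by (auto simp: symmetries_def)
  show "P_hat p n (relabel \<sigma> x) = P_hat p n x"
    unfolding P_hat_def
    using prod.permute[OF \<sigma>(1), of "\<lambda>j. [:- x (Zeta j), 1:] ^ n j"] by (simp add: comp_def \<sigma>(2))
  have "cofactor p n (relabel \<sigma> x) k = cofactor p n x (\<sigma> k)" if "k \<in> {1..p}" for k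
  proof -
    have "bij_betw \<sigma> ({1..p} - {k}) ({1..p} - {\<sigma> k})"
      using permutes_inj_on[OF \<sigma>(1)] image_set_diff[OF permutes_inj[OF \<sigma>(1)], of "{1..p}" "{k}"]
        permutes_image[OF \<sigma>(1)] by (simp add: bij_betw_def)
    from prod.reindex_bij_betw[OF this, of "\<lambda>j. [:- x (Zeta j), 1:] ^ n j"] show ?thesis
      by (simp add: cofactor_def \<sigma>(2))
  qed
  moreover have "principal_part n (relabel \<sigma> x) k = principal_part n x (\<sigma> k)" for k
    by (simp add: principal_part_def \<sigma>(2))
  ultimately have "Q_poly p n (relabel \<sigma> x) =
      (\<Sum>k=1..p. principal_part n x (\<sigma> k) * cofactor p n x (\<sigma> k))"
    unfolding Q_poly_eq by simp
  also have "\<dots> = Q_poly p n x"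
    unfolding Q_poly_eq
    using sum.permute[OF \<sigma>(1), of "\<lambda>k. principal_part n x k * cofactor p n x k"] by (simp add: comp_def)
  finally show "Q_poly p n (relabel \<sigma> x) = Q_poly p n x" .
qed

text \<open>
  Equal coefficients give the same polynomial \<open>F\<close>, so the zeros of the second point are a
  permutation \<open>\<sigma>\<close> of those of the first, and comparing orders shows \<open>n \<circ> \<sigma> = n\<close>. The relabelled
  first point then has the same zeros and the same \<open>Q\<close> as the second one, and \<open>E_eqI\<close> applies.
\<close>

lemma coeff_map_fibre:
  assumes x: "x \<in> E" and y: "y \<in> E"
  shows "coeff_map x = coeff_map y \<longleftrightarrow> (\<exists>\<sigma>\<in>symmetries. y = relabel \<sigma> x)"
proof
  assume eq: "coeff_map x = coeff_map y"
  note PQ = coeff_map_eqD[OF x y eq]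
  let ?zx = "\<lambda>k. x (Zeta k)" and ?zy = "\<lambda>k. y (Zeta k)"
  have im: "?zx ` {1..p} = ?zy ` {1..p}"
    using poly_P_hat_eq_0_iff[of x] poly_P_hat_eq_0_iff[of y] PQ(1) by (auto simp: image_iff)
  define \<sigma> where "\<sigma> = (\<lambda>k. if k \<in> {1..p} then inv_into {1..p} ?zx (?zy k) else k)"
  have bx: "bij_betw (inv_into {1..p} ?zx) (?zx ` {1..p}) {1..p}"
    using E_inj[OF x] by (intro bij_betw_inv_into) (simp add: bij_betw_def)
  have "bij_betw ?zy {1..p} (?zx ` {1..p})"
    using E_inj[OF y] im by (simp add: bij_betw_def)
  from bij_betw_trans[OF this bx] have "bij_betw \<sigma> {1..p} {1..p}"
    by (rule bij_betw_cong[THEN iffD1, rotated]) (simp add: \<sigma>_def)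
  then have perm: "\<sigma> permutes {1..p}"
    by (rule bij_imp_permutes) (auto simp: \<sigma>_def)
  have zs: "x (Zeta (\<sigma> k)) = y (Zeta k)" if "k \<in> {1..p}" for k
    using f_inv_into_f[of "?zy k" ?zx "{1..p}"] im that by (auto simp: \<sigma>_def)
  have "n (\<sigma> k) = n k" for k
  proof (cases "k \<in> {1..p}")
    case True
    then show ?thesis
      using order_P_hat[OF E_inj[OF x], of "\<sigma> k"] order_P_hat[OF E_inj[OF y] True] zs[OF True]
        permutes_in_image[OF perm, of k] PQ(1) by simp
  next
    case False
    then show ?thesis by (auto simp: \<sigma>_def)
  qed
  with perm have s: "\<sigma> \<in> symmetries" by (simp add: symmetries_def)
  have "y = relabel \<sigma> x"
    using zs PQ(2) Q_poly_relabel[OF s, of x] by (intro E_eqI y relabel_E s x) auto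
  with s show "\<exists>\<sigma>\<in>symmetries. y = relabel \<sigma> x" by blast
next
  assume "\<exists>\<sigma>\<in>symmetries. y = relabel \<sigma> x"
  then show "coeff_map x = coeff_map y"
    by (auto simp: coeff_map_def P_hat_relabel Q_poly_relabel)
qed

lemma relabel_free:
  assumes x: "x \<in> E" and "\<sigma> \<in> symmetries" "\<tau> \<in> symmetries" "relabel \<sigma> x = relabel \<tau> x"
  shows "\<sigma> = \<tau>"
proof
  fix k
  have \<sigma>: "\<sigma> permutes {1..p}" "\<tau> permutes {1..p}" using assms by (auto simp: symmetries_def)
  show "\<sigma> k = \<tau> k"
  proof (cases "k \<in> {1..p}")
    case True
    have "x (Zeta (\<sigma> k)) = x (Zeta (\<tau> k))" using fun_cong[OF assms(4), of "Zeta k"] by simp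
    then show ?thesis
      using inj_onD[OF E_inj[OF x]] True permutes_in_image[OF \<sigma>(1), of k]
        permutes_in_image[OF \<sigma>(2), of k] by blast
  qed (use \<sigma> in \<open>simp add: permutes_not_in\<close>)
qed

lemma finite_symmetries: "finite symmetries"
  by (rule finite_subset[OF _ finite_permutations[of "{1..p}"]]) (auto simp: symmetries_def)

lemma id_symmetries: "id \<in> symmetries"
  by (simp add: symmetries_def permutes_id)

lemma relabel_id: "relabel id = id"
  by (intro ext) (simp add: relabel_def split: param_index.splits)

lemma symmetries_inverse:
  assumes "\<sigma> \<in> symmetries"
  shows "inv \<sigma> \<in> symmetries" "relabel (inv \<sigma>) (relabel \<sigma> x) = x" "relabel \<sigma> (relabel (inv \<sigma>) x) = x"
proof -
  have \<sigma>: "\<sigma> permutes {1..p}" "\<And>k. n (\<sigma> k) = n k" using assms by (auto simp: symmetries_def)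
  note inverses = permutes_inverses[OF \<sigma>(1)]
  have "n (inv \<sigma> k) = n k" for k using \<sigma>(2)[of "inv \<sigma> k"] inverses by simp
  with permutes_inv[OF \<sigma>(1)] show "inv \<sigma> \<in> symmetries" by (simp add: symmetries_def)
  show "relabel (inv \<sigma>) (relabel \<sigma> x) = x" "relabel \<sigma> (relabel (inv \<sigma>) x) = x"
    by (auto simp: relabel_def inverses split: param_index.splits)
qed

end


section \<open>Dependence of the coefficients on the parameters\<close>

definition coeffs_cdifferentiable ::
    "'i set \<Rightarrow> (('i \<Rightarrow> complex) \<Rightarrow> complex poly) \<Rightarrow> ('i \<Rightarrow> complex) \<Rightarrow> bool" where
  "coeffs_cdifferentiable I f x \<longleftrightarrow> (\<forall>j. cdifferentiable I (\<lambda>z. coeff (f z) j) x)"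

context
  fixes I :: "'i set" and x :: "'i \<Rightarrow> complex"
  assumes I: "finite I" "x \<in> cvec I"
begin

lemma coeffs_cdifferentiable_const: "coeffs_cdifferentiable I (\<lambda>_. f) x"
  by (simp add: coeffs_cdifferentiable_def cdifferentiable_const I)

lemma coeffs_cdifferentiable_diff:
  "coeffs_cdifferentiable I f x \<Longrightarrow> coeffs_cdifferentiable I g x \<Longrightarrow>
    coeffs_cdifferentiable I (\<lambda>z. f z - g z) x"
  by (simp add: coeffs_cdifferentiable_def cdifferentiable_diff I)

lemma coeffs_cdifferentiable_mult:
  "coeffs_cdifferentiable I f x \<Longrightarrow> coeffs_cdifferentiable I g x \<Longrightarrow>
    coeffs_cdifferentiable I (\<lambda>z. f z * g z) x"
  unfolding coeffs_cdifferentiable_def coeff_mult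
  by (intro allI cdifferentiable_sum cdifferentiable_mult I) auto

lemma coeffs_cdifferentiable_sum:
  "(\<And>a. a \<in> A \<Longrightarrow> coeffs_cdifferentiable I (f a) x) \<Longrightarrow>
    coeffs_cdifferentiable I (\<lambda>z. \<Sum>a\<in>A. f a z) x"
  unfolding coeffs_cdifferentiable_def coeff_sum
  by (intro allI cdifferentiable_sum I) auto

lemma coeffs_cdifferentiable_prod:
  "(\<And>a. a \<in> A \<Longrightarrow> coeffs_cdifferentiable I (f a) x) \<Longrightarrow>
    coeffs_cdifferentiable I (\<lambda>z. \<Prod>a\<in>A. f a z) x"
  by (induction A rule: infinite_finite_induct)
     (simp_all add: coeffs_cdifferentiable_const coeffs_cdifferentiable_mult)

lemma coeffs_cdifferentiable_power:
  "coeffs_cdifferentiable I f x \<Longrightarrow> coeffs_cdifferentiable I (\<lambda>z. f z ^ m) x"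
  by (induction m) (simp_all add: coeffs_cdifferentiable_const coeffs_cdifferentiable_mult)

lemma coeffs_cdifferentiable_smult:
  "coeffs_cdifferentiable I f x \<Longrightarrow> coeffs_cdifferentiable I (\<lambda>z. smult (z i) (f z)) x"
  by (simp add: coeffs_cdifferentiable_def cdifferentiable_mult cdifferentiable_coord I)

lemma coeffs_cdifferentiable_linear: "coeffs_cdifferentiable I (\<lambda>z. [:- z i, 1:]) x"
proof -
  have "cdifferentiable I (\<lambda>z. coeff [:- z i, 1:] j) x" for j
  proof (cases j)
    case 0
    then show ?thesis by (simp add: cdifferentiable_uminus cdifferentiable_coord I)
  next
    case (Suc k)
    then show ?thesis by (simp add: cdifferentiable_const I)
  qed
  then show ?thesis by (simp add: coeffs_cdifferentiable_def)
qed

end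

lemma cdifferentiable_imp_LIMSEQ:
  assumes "finite I" "l \<in> cvec I" "cdifferentiable I f l" "\<And>m. X m \<in> cvec I" "X \<longlonglongrightarrow> l"
  shows "(\<lambda>m. f (X m)) \<longlonglongrightarrow> f l"
proof (rule filterlim_compose[OF cdifferentiable_imp_tendsto[OF assms(1-3)]])
  show "filterlim X (cnear I l) sequentially"
    unfolding cnear_def
    by (intro filterlim_inf[THEN iffD2] conjI assms(5)) (simp add: filterlim_principal assms(4))
qed

lemma coeffs_cdifferentiable_P_hat:
  "finite I \<Longrightarrow> x \<in> cvec I \<Longrightarrow> coeffs_cdifferentiable I (P_hat p n) x"
  unfolding P_hat_def[abs_def]
  by (intro coeffs_cdifferentiable_prod coeffs_cdifferentiable_power coeffs_cdifferentiable_linear)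

lemma coeffs_cdifferentiable_Q_poly:
  "finite I \<Longrightarrow> x \<in> cvec I \<Longrightarrow> coeffs_cdifferentiable I (Q_poly p n) x"
  unfolding Q_poly_def[abs_def]
  by (intro coeffs_cdifferentiable_sum coeffs_cdifferentiable_mult coeffs_cdifferentiable_smult
      coeffs_cdifferentiable_prod coeffs_cdifferentiable_power coeffs_cdifferentiable_linear)

lemma cdifferentiable_coeff_vector:
  assumes "finite I" "x \<in> cvec I" "coeffs_cdifferentiable I f x" "coeffs_cdifferentiable I g x"
  shows "cdifferentiable I (\<lambda>z. coeff_vector d (f z) (g z) i) x"
proof (cases i)
  case (Num_coeff j)
  then show ?thesis
    using assms by (cases "j \<le> d")
      (simp_all add: coeffs_cdifferentiable_def coeff_vector_def cdifferentiable_const)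
next
  case (Den_coeff j)
  then show ?thesis
    using assms by (cases "j < d")
      (simp_all add: coeffs_cdifferentiable_def coeff_vector_def cdifferentiable_const)
qed


section \<open>Properness\<close>

text \<open>
  Cauchy's bound: for \<open>|z| > 1\<close> divide \<open>z\<^sup>D = - \<Sum> c\<^sub>i z\<^sup>i\<close> by the largest power of \<open>z\<close> on the right.
\<close>

lemma norm_root_le:
  fixes f :: "complex poly"
  assumes root: "poly f z = 0" and monic: "lead_coeff f = 1"
  shows "norm z \<le> 1 + (\<Sum>i<degree f. norm (coeff f i))"
proof (cases "norm z \<le> 1")
  case True
  then show ?thesis by (simp add: add_increasing2 sum_nonneg)
next
  case False
  let ?S = "\<Sum>i<degree f. norm (coeff f i)"
  have "degree f \<noteq> 0"
  proof
    assume "degree f = 0"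
    then obtain c where "f = [:c:]" by (rule degree_eq_zeroE)
    with root monic show False by simp
  qed
  then obtain D where D: "degree f = Suc D" using not0_implies_Suc by blast
  have "0 = (\<Sum>i\<le>Suc D. coeff f i * z ^ i)"
    using root by (simp only: poly_altdef D)
  also have "\<dots> = (\<Sum>i<Suc D. coeff f i * z ^ i) + z ^ Suc D"
    using monic by (simp add: D lessThan_Suc_atMost)
  finally have "norm (z ^ Suc D) = norm (\<Sum>i<Suc D. coeff f i * z ^ i)"
    by (metis add_eq_0_iff norm_minus_cancel)
  also have "\<dots> \<le> (\<Sum>i<Suc D. norm (coeff f i) * norm z ^ D)"
  proof (intro order_trans[OF norm_sum] sum_mono)
    fix i assume "i \<in> {..<Suc D}"
    then have "norm z ^ i \<le> norm z ^ D" using False by (intro power_increasing) auto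
    then show "norm (coeff f i * z ^ i) \<le> norm (coeff f i) * norm z ^ D"
      by (simp add: norm_mult norm_power mult_left_mono)
  qed
  also have "\<dots> = ?S * norm z ^ D" by (simp only: D sum_distrib_right)
  finally have "norm z * norm z ^ D \<le> ?S * norm z ^ D" by (simp add: norm_power norm_mult)
  moreover have "norm z ^ D > 0" using False by (intro zero_less_power) auto
  ultimately have "norm z \<le> ?S" by simp
  then show ?thesis by simp
qed

lemma bounded_coordinates_subseq:
  fixes X :: "nat \<Rightarrow> 'i \<Rightarrow> complex"
  assumes "finite I" "\<And>i. i \<in> I \<Longrightarrow> bounded (range (\<lambda>m. X m i))"
  shows "\<exists>r l. strict_mono r \<and> (\<forall>i\<in>I. (\<lambda>m. X (r m) i) \<longlonglongrightarrow> l i)"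
  using assms
proof (induction I rule: finite_induct)
  case empty
  have "strict_mono (\<lambda>m::nat. m)" by (simp add: strict_mono_def)
  then show ?case by blast
next
  case (insert i I)
  then obtain r l where r: "strict_mono r" "\<forall>i\<in>I. (\<lambda>m. X (r m) i) \<longlonglongrightarrow> l i" by blast
  have "bounded (range (\<lambda>m. X (r m) i))"
    using insert.prems[of i] by (rule bounded_subset) auto
  then obtain a s where s: "strict_mono s" "((\<lambda>m. X (r m) i) \<circ> s) \<longlonglongrightarrow> a"
    using bounded_imp_convergent_subsequence by blast
  have "(\<lambda>m. X ((r \<circ> s) m) j) \<longlonglongrightarrow> (l(i := a)) j" if "j \<in> insert i I" for j
  proof (cases "j = i")
    case True
    then show ?thesis using s(2) by (simp add: comp_def)
  next
    case False
    then have "(\<lambda>m. X (r m) j) \<longlonglongrightarrow> l j" using that r(2) by blast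
    from LIMSEQ_subseq_LIMSEQ[OF this s(1)] show ?thesis using False by (simp add: comp_def)
  qed
  then show ?case
    using strict_mono_o[OF r(1) s(1)] by blast
qed

text \<open>
  Scaling the \<open>\<alpha>\<close>-coordinates multiplies \<open>Q\<close> by the same factor and keeps \<open>F\<close>; it is used to bring
  an a priori unbounded sequence of parameters into a compact set.
\<close>

definition scale_alpha :: "complex \<Rightarrow> (param_index \<Rightarrow> complex) \<Rightarrow> param_index \<Rightarrow> complex" where
  "scale_alpha c x = (\<lambda>i. case i of Zeta k \<Rightarrow> x (Zeta k) | Alpha k l \<Rightarrow> c * x (Alpha k l))"

lemma scale_alpha_simps [simp]:
  "scale_alpha c x (Zeta k) = x (Zeta k)" "scale_alpha c x (Alpha k l) = c * x (Alpha k l)"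
  by (simp_all add: scale_alpha_def)

lemma scale_alpha_cvec: "x \<in> cvec I \<Longrightarrow> scale_alpha c x \<in> cvec I"
  by (auto simp: cvec_def scale_alpha_def split: param_index.splits)

lemma P_hat_scale_alpha: "P_hat p n (scale_alpha c x) = P_hat p n x"
  by (simp add: P_hat_def)

lemma smult_sum_right: "smult c (\<Sum>a\<in>A. f a) = (\<Sum>a\<in>A. smult c (f a))"
  by (induction A rule: infinite_finite_induct) (simp_all add: smult_add_right)

lemma Q_poly_scale_alpha: "Q_poly p n (scale_alpha c x) = smult c (Q_poly p n x)"
proof -
  have "principal_part n (scale_alpha c x) k = smult c (principal_part n x k)" for k
    by (simp add: principal_part_def smult_sum_right)
  moreover have "cofactor p n (scale_alpha c x) k = cofactor p n x k" for k
    by (simp add: cofactor_def)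
  ultimately show ?thesis by (simp add: Q_poly_eq smult_sum_right)
qed

context overlap_data
begin

lemma cdifferentiable_coeff_map:
  assumes "x \<in> cvec I"
  shows "cdifferentiable I (\<lambda>z. coeff_map z j) x"
  unfolding coeff_map_def
  using finite_I assms
  by (intro cdifferentiable_coeff_vector coeffs_cdifferentiable_diff coeffs_cdifferentiable_mult
      coeffs_cdifferentiable_const coeffs_cdifferentiable_P_hat
      coeffs_cdifferentiable_Q_poly)

lemma LIMSEQ_coeffs:
  assumes "\<And>m. X m \<in> cvec I" "l \<in> cvec I" "X \<longlonglongrightarrow> l"
  shows "(\<lambda>m. coeff (P_hat p n (X m)) j) \<longlonglongrightarrow> coeff (P_hat p n l) j"
    and "(\<lambda>m. coeff (Q_poly p n (X m)) j) \<longlonglongrightarrow> coeff (Q_poly p n l) j"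
    and "(\<lambda>m. coeff_map (X m)) \<longlonglongrightarrow> coeff_map l"
  using coeffs_cdifferentiable_P_hat[OF finite_I assms(2)]
    coeffs_cdifferentiable_Q_poly[OF finite_I assms(2)] cdifferentiable_coeff_map[OF assms(2)]
    cdifferentiable_imp_LIMSEQ[OF finite_I assms(2) _ assms(1,3)]
  unfolding coeffs_cdifferentiable_def tendsto_fun_iff by blast+

lemma no_common_zero:
  assumes "x \<in> E" "poly (P_hat p n x) z = 0"
  shows "poly (Q_poly p n x) z \<noteq> 0"
proof -
  have "poly (P_poly x) z \<noteq> 0 \<or> poly (Q_poly p n x) z \<noteq> 0"
    using canonical_rep_Pi_proj[OF assms(1)] unfolding canonical_rep_def by blast
  with assms(2) show ?thesis by auto
qed

lemma coeff_Q_poly_E: "x \<in> E \<Longrightarrow> coeff (Q_poly p n x) d = 1"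
  using coeff_Q_poly_top by (simp add: E_tilde_def)

text \<open>
  The coefficient vector does not list the leading coefficient of \<open>Q\<close>, which is constantly \<open>1\<close>;
  the coefficients of \<open>F = z Q - P\<close> follow from those of \<open>P\<close> and \<open>Q\<close>.
\<close>

lemma LIMSEQ_coeff_mapD:
  assumes X: "\<And>m. X m \<in> E" and x: "x \<in> E" and lim: "(\<lambda>m. coeff_map (X m)) \<longlonglongrightarrow> coeff_map x"
  shows "(\<lambda>m. coeff (Q_poly p n (X m)) j) \<longlonglongrightarrow> coeff (Q_poly p n x) j"
    and "(\<lambda>m. coeff (P_hat p n (X m)) j) \<longlonglongrightarrow> coeff (P_hat p n x) j"
proof -
  have lim': "(\<lambda>m. coeff_map (X m) i) \<longlonglongrightarrow> coeff_map x i" for i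
    using lim by (simp add: tendsto_fun_iff)
  show Q: "(\<lambda>m. coeff (Q_poly p n (X m)) j) \<longlonglongrightarrow> coeff (Q_poly p n x) j" for j
  proof -
    consider "j < d" | "j = d" | "j > d" by linarith
    then show ?thesis
    proof cases
      case 1
      then show ?thesis using lim'[of "Den_coeff j"] by (simp add: coeff_map_def coeff_vector_def)
    next
      case 2
      then show ?thesis using X x by (simp add: coeff_Q_poly_E)
    next
      case 3
      then have "coeff (Q_poly p n z) j = 0" for z
        using degree_Q_poly[of z] by (intro coeff_eq_0) simp
      then show ?thesis by simp
    qed
  qed
  have P: "(\<lambda>m. coeff (P_poly (X m)) j) \<longlonglongrightarrow> coeff (P_poly x) j"
  proof (cases "j \<le> d")
    case True
    then show ?thesis using lim'[of "Num_coeff j"] by (simp add: coeff_map_def coeff_vector_def)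
  next
    case False
    then have "coeff (P_poly z) j = 0" if "z \<in> E" for z
      using canonical_rep_Pi_proj[OF that] by (intro coeff_eq_0) (simp add: canonical_rep_def)
    then show ?thesis using X x by simp
  qed
  have "(\<lambda>m. coeff ([:0, 1:] * Q_poly p n (X m)) j) \<longlonglongrightarrow> coeff ([:0, 1:] * Q_poly p n x) j"
    using Q by (cases j) simp_all
  from tendsto_diff[OF this P] show "(\<lambda>m. coeff (P_hat p n (X m)) j) \<longlonglongrightarrow> coeff (P_hat p n x) j"
    by simp
qed

lemma bounded_fixed_points:
  assumes X: "\<And>m. X m \<in> E" and x: "x \<in> E" and lim: "(\<lambda>m. coeff_map (X m)) \<longlonglongrightarrow> coeff_map x"
    and k: "k \<in> {1..p}"
  shows "bounded (range (\<lambda>m. X m (Zeta k)))"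
proof -
  let ?S = "\<lambda>z. 1 + (\<Sum>i<d + 1. norm (coeff (P_hat p n z) i))"
  have "(\<lambda>m. ?S (X m)) \<longlonglongrightarrow> ?S x"
    by (intro tendsto_intros LIMSEQ_coeff_mapD(2)[OF X x lim])
  from convergent_imp_Bseq[OF convergentI[OF this]]
  obtain K where K: "\<And>m. norm (?S (X m)) \<le> K" by (elim BseqE) blast
  have "norm (X m (Zeta k)) \<le> K" for m
  proof -
    have "norm (X m (Zeta k)) \<le> ?S (X m)"
      using norm_root_le[of "P_hat p n (X m)" "X m (Zeta k)"] degree_P_hat[of "X m"]
        coeff_P_hat_top[of "X m"] poly_P_hat_Zeta[OF k, of "X m"] by simp
    then show ?thesis using K[of m] by simp
  qed
  then show ?thesis unfolding bounded_iff by blast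
qed

text \<open>
  The \<open>\<zeta>\<close>-coordinates are bounded by Cauchy's bound. Scaling the \<open>\<alpha>\<close>-coordinates by
  \<open>t m = 1 / (1 + s m)\<close>, where \<open>s m\<close> is their total size, makes all coordinates bounded, and a
  subsequence of the scaled points \<open>Y m\<close> and of the factors \<open>t m\<close> converges, to \<open>y\<close> and \<open>c\<close>. In
  the limit \<open>F\<close> is that of \<open>x\<close>, so the \<open>p\<close> zeros of \<open>y\<close> are still distinct, and \<open>Q\<close> is \<open>c\<close>
  times that of \<open>x\<close>. If \<open>c\<close> were \<open>0\<close>, uniqueness of partial fractions would annihilate all
  \<open>\<alpha>\<close>-coordinates of \<open>y\<close>, whose total size is \<open>1 - c\<close>. Hence the scaling can be undone in the limit.
\<close>

lemma coeff_map_proper: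
  assumes X: "\<And>m. X m \<in> E" and x: "x \<in> E" and lim: "(\<lambda>m. coeff_map (X m)) \<longlonglongrightarrow> coeff_map x"
  shows "\<exists>r l. strict_mono r \<and> l \<in> E \<and> (\<lambda>m. X (r m)) \<longlonglongrightarrow> l"
proof -
  define A where "A = I - Zeta ` {1..p}"
  have finA: "finite A" by (simp add: A_def finite_I)
  have A_Alpha: "\<exists>k l. i = Alpha k l" if "i \<in> A" for i
    using that by (cases i) (auto simp: A_def)
  define s where "s m = (\<Sum>i\<in>A. norm (X m i))" for m
  define t where "t m = 1 / (1 + s m)" for m
  have s0: "s m \<ge> 0" for m by (simp add: s_def sum_nonneg)
  have t: "0 < t m" "t m \<le> 1" for m using s0[of m] by (auto simp: t_def)
  define Y where "Y m = scale_alpha (of_real (t m)) (X m)" for m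
  have Ycv: "Y m \<in> cvec I" for m using X[of m] E_cvec by (auto simp: Y_def scale_alpha_cvec)
  have YA: "Y m i = of_real (t m) * X m i" if "i \<in> A" for m i
    using A_Alpha[OF that] by (auto simp: Y_def)
  have sumY: "(\<Sum>i\<in>A. norm (Y m i)) = 1 - t m" for m
  proof -
    have "(\<Sum>i\<in>A. norm (Y m i)) = (\<Sum>i\<in>A. t m * norm (X m i))"
      using t(1)[of m] by (intro sum.cong) (auto simp: YA norm_mult)
    also have "\<dots> = t m * s m" by (simp add: s_def sum_distrib_left)
    also have "\<dots> = 1 - t m" using s0[of m] by (simp add: t_def field_simps)
    finally show ?thesis .
  qed
  have bdY: "bounded (range (\<lambda>m. Y m i))" if "i \<in> I" for i
  proof (cases "i \<in> A")
    case True
    have "norm (Y m i) \<le> 1" for m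
      using member_le_sum[of i A "\<lambda>i. norm (Y m i)"] True finA sumY[of m] t[of m] by simp
    then show ?thesis unfolding bounded_iff by blast
  next
    case False
    with that obtain k where "k \<in> {1..p}" "i = Zeta k" by (auto simp: A_def)
    then show ?thesis using bounded_fixed_points[OF X x lim] by (simp add: Y_def)
  qed
  \<comment> \<open>The index \<open>None\<close> carries the scaling factor, so that one subsequence serves everything.\<close>
  define Z where "Z m i = (case i of None \<Rightarrow> of_real (t m) | Some i \<Rightarrow> Y m i)" for m i
  have "bounded (range (\<lambda>m. Z m i))" if "i \<in> insert None (Some ` I)" for i
  proof (cases i)
    case None
    have "norm (Z m i) \<le> 1" for m using t[of m] None by (simp add: Z_def)
    then show ?thesis unfolding bounded_iff by blast
  next
    case (Some j)
    then show ?thesis using that bdY[of j] by (auto simp: Z_def)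
  qed
  then obtain r L where r: "strict_mono r"
    and L: "\<forall>i\<in>insert None (Some ` I). (\<lambda>m. Z (r m) i) \<longlonglongrightarrow> L i"
    using bounded_coordinates_subseq[of "insert None (Some ` I)" Z] finite_I by auto
  define c where "c = L None"
  have tc: "(\<lambda>m. complex_of_real (t (r m))) \<longlonglongrightarrow> c" using L by (auto simp: c_def Z_def)
  define y where "y i = (if i \<in> I then L (Some i) else 0)" for i
  have ycv: "y \<in> cvec I" by (simp add: cvec_def y_def)
  have Yy: "(\<lambda>m. Y (r m)) \<longlonglongrightarrow> y"
    unfolding tendsto_fun_iff
  proof
    fix i show "(\<lambda>m. Y (r m) i) \<longlonglongrightarrow> y i"
      using L Ycv by (cases "i \<in> I") (auto simp: Z_def y_def cvec_def)
  qed
  have lim_r: "(\<lambda>m. coeff (P_hat p n (X (r m))) j) \<longlonglongrightarrow> coeff (P_hat p n x) j"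
    "(\<lambda>m. coeff (Q_poly p n (X (r m))) j) \<longlonglongrightarrow> coeff (Q_poly p n x) j" for j
    using LIMSEQ_subseq_LIMSEQ[OF LIMSEQ_coeff_mapD(1)[OF X x lim] r]
      LIMSEQ_subseq_LIMSEQ[OF LIMSEQ_coeff_mapD(2)[OF X x lim] r] by (simp_all add: comp_def)
  have Py: "P_hat p n y = P_hat p n x"
  proof (rule poly_eqI)
    fix j show "coeff (P_hat p n y) j = coeff (P_hat p n x) j"
      using LIMSEQ_coeffs(1)[OF Ycv ycv Yy, of j] lim_r(1)[of j]
      by (intro LIMSEQ_unique) (simp_all add: Y_def P_hat_scale_alpha)
  qed
  have Qy: "Q_poly p n y = smult c (Q_poly p n x)"
  proof (rule poly_eqI)
    fix j show "coeff (Q_poly p n y) j = coeff (smult c (Q_poly p n x)) j"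
      using LIMSEQ_coeffs(2)[OF Ycv ycv Yy, of j] tendsto_mult[OF tc lim_r(2)[of j]]
      by (intro LIMSEQ_unique) (simp_all add: Y_def Q_poly_scale_alpha)
  qed
  have inj: "inj_on (\<lambda>k. y (Zeta k)) {1..p}"
  proof (rule eq_card_imp_inj_on)
    have "(\<lambda>k. y (Zeta k)) ` {1..p} = (\<lambda>k. x (Zeta k)) ` {1..p}"
      using P_hat_zeros[of x] P_hat_zeros[of y] Py by simp
    then show "card ((\<lambda>k. y (Zeta k)) ` {1..p}) = card {1..p}"
      using card_image[OF E_inj[OF x]] by simp
  qed simp
  have c0: "c \<noteq> 0"
  proof
    assume c: "c = 0"
    have "Q_poly p n y = Q_poly p n (scale_alpha 0 y)"
      by (simp add: Qy c Q_poly_scale_alpha)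
    then have "principal_part n y k = principal_part n (scale_alpha 0 y) k" if "k \<in> {1..p}" for k
      using that by (intro principal_part_eqI[OF inj]) auto
    then have "y (Alpha k l) = 0" if "k \<in> {1..p}" "l \<in> {1..n k}" for k l
      using principal_part_eqD[of n y k "scale_alpha 0 y" l] that by simp
    then have "y i = 0" if "i \<in> A" for i
      using that A_Alpha[OF that] by (auto simp: A_def)
    then have "(\<Sum>i\<in>A. norm (y i)) = 0" by simp
    moreover have "(\<lambda>m. \<Sum>i\<in>A. norm (Y (r m) i)) \<longlonglongrightarrow> (\<Sum>i\<in>A. norm (y i))"
      using Yy unfolding tendsto_fun_iff by (intro tendsto_intros) blast
    ultimately have "(\<lambda>m. 1 - t (r m)) \<longlonglongrightarrow> 0" by (simp add: sumY)
    moreover have "(\<lambda>m. t (r m)) \<longlonglongrightarrow> 0"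
      using tc unfolding c by (metis of_real_0 tendsto_of_real_iff)
    ultimately have "(\<lambda>m. (1 - t (r m)) + t (r m)) \<longlonglongrightarrow> 0 + 0" by (rule tendsto_add)
    then show False using LIMSEQ_unique tendsto_const by fastforce
  qed
  define l where "l = scale_alpha (1 / c) y"
  have lcv: "l \<in> cvec I" using ycv by (simp add: l_def scale_alpha_cvec)
  have "(\<lambda>m. X (r m) i) \<longlonglongrightarrow> l i" for i
  proof (cases i)
    case (Zeta k)
    have "(\<lambda>m. Y (r m) (Zeta k)) \<longlonglongrightarrow> y (Zeta k)" using Yy by (simp add: tendsto_fun_iff)
    then show ?thesis by (simp add: Zeta Y_def l_def)
  next
    case (Alpha k j)
    have "(\<lambda>m. Y (r m) (Alpha k j) / of_real (t (r m))) \<longlonglongrightarrow> y (Alpha k j) / c"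
      using Yy tc c0 by (intro tendsto_divide) (auto simp: tendsto_fun_iff)
    moreover have "complex_of_real (t m) \<noteq> 0" for m using t(1)[of m] by simp
    ultimately show ?thesis by (simp add: Alpha Y_def l_def)
  qed
  then have Xl: "(\<lambda>m. X (r m)) \<longlonglongrightarrow> l" by (simp add: tendsto_fun_iff)
  have Pl: "P_hat p n l = P_hat p n x" by (simp add: l_def P_hat_scale_alpha Py)
  have Ql: "Q_poly p n l = Q_poly p n x" using c0 by (simp add: l_def Q_poly_scale_alpha Qy)
  have "l (Alpha k (n k)) \<noteq> 0" if k: "k \<in> {1..p}" for k
    using poly_Q_poly[OF k, of l] no_common_zero[OF x, of "l (Zeta k)"] poly_P_hat_Zeta[OF k, of l] Pl Ql
    by auto
  moreover have "(\<Sum>k=1..p. l (Alpha k 1)) = 1"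
    using coeff_Q_poly_top[of l] coeff_Q_poly_E[OF x] Ql by simp
  moreover have "inj_on (\<lambda>k. l (Zeta k)) {1..p}" using inj by (simp add: l_def)
  ultimately have "l \<in> E" using lcv by (simp add: E_tilde_def)
  with r Xl show ?thesis by blast
qed

lemma LIMSEQ_relabel: "X \<longlonglongrightarrow> l \<Longrightarrow> (\<lambda>m. relabel \<sigma> (X m)) \<longlonglongrightarrow> relabel \<sigma> l"
  unfolding tendsto_fun_iff by (auto simp: relabel_def split: param_index.splits)

text \<open>
  If points outside the image of \<open>U\<close> converged to \<open>coeff_map x\<close> with \<open>x \<in> U\<close>, then by properness
  some of their preimages would converge to a point of the fibre of \<open>x\<close>, and after relabelling to
  \<open>x\<close> itself, hence would enter \<open>U\<close>.
\<close>

lemma coeff_map_open: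
  assumes U: "openin (top_of_set E) U"
  shows "openin (top_of_set (coeff_map ` E)) (coeff_map ` U)"
  unfolding openin_euclidean_subtopology_iff
proof (intro conjI ballI)
  have UE: "U \<subseteq> E" using U by (rule openin_imp_subset)
  then show "coeff_map ` U \<subseteq> coeff_map ` E" by (rule image_mono)
  fix y assume "y \<in> coeff_map ` U"
  then obtain x where x: "x \<in> U" "y = coeff_map x" by blast
  show "\<exists>e>0. \<forall>y'\<in>coeff_map ` E. dist y' y < e \<longrightarrow> y' \<in> coeff_map ` U"
  proof (rule ccontr)
    assume neg: "\<not> ?thesis"
    have "\<exists>z\<in>E. dist (coeff_map z) y < 1 / real (Suc m) \<and> coeff_map z \<notin> coeff_map ` U" for m
    proof -
      have "1 / real (Suc m) > 0" by simp
      with neg show ?thesis by blast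
    qed
    then obtain X where X: "\<And>m. X m \<in> E" "\<And>m. dist (coeff_map (X m)) y < 1 / real (Suc m)"
      "\<And>m. coeff_map (X m) \<notin> coeff_map ` U" by metis
    have "(\<lambda>m. dist (coeff_map (X m)) y) \<longlonglongrightarrow> 0"
    proof (rule tendsto_sandwich[OF _ _ tendsto_const LIMSEQ_inverse_real_of_nat])
      show "\<forall>\<^sub>F m in sequentially. dist (coeff_map (X m)) y \<le> inverse (real (Suc m))"
        using X(2) by (intro always_eventually allI less_imp_le) (simp add: inverse_eq_divide)
    qed simp
    then have lim: "(\<lambda>m. coeff_map (X m)) \<longlonglongrightarrow> coeff_map x"
      unfolding x(2) by (rule tendsto_dist_iff[THEN iffD2])
    have xE: "x \<in> E" using x UE by blast
    from coeff_map_proper[OF X(1) xE lim] obtain r l where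
      r: "strict_mono r" and l: "l \<in> E" "(\<lambda>m. X (r m)) \<longlonglongrightarrow> l" by blast
    have "(\<lambda>m. coeff_map (X (r m))) \<longlonglongrightarrow> coeff_map l"
      using X(1) l E_cvec by (intro LIMSEQ_coeffs(3)) auto
    moreover have "(\<lambda>m. coeff_map (X (r m))) \<longlonglongrightarrow> coeff_map x"
      using LIMSEQ_subseq_LIMSEQ[OF lim r] by (simp add: comp_def)
    ultimately have "coeff_map l = coeff_map x" by (rule LIMSEQ_unique)
    then obtain \<sigma> where \<sigma>: "\<sigma> \<in> symmetries" "x = relabel \<sigma> l"
      using coeff_map_fibre[OF l(1) xE] by blast
    obtain V where V: "open V" "U = E \<inter> V" using U by (auto simp: openin_open)
    have "(\<lambda>m. relabel \<sigma> (X (r m))) \<longlonglongrightarrow> x"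
      unfolding \<sigma>(2) using l(2) by (rule LIMSEQ_relabel)
    then have "\<forall>\<^sub>F m in sequentially. relabel \<sigma> (X (r m)) \<in> V"
      using V x(1) by (intro topological_tendstoD) auto
    then obtain m where "relabel \<sigma> (X (r m)) \<in> V"
      using eventually_happens trivial_limit_sequentially by blast
    then have "relabel \<sigma> (X (r m)) \<in> U"
      using V(2) relabel_E[OF \<sigma>(1) X(1)] by blast
    moreover have "coeff_map (relabel \<sigma> (X (r m))) = coeff_map (X (r m))"
      using P_hat_relabel[OF \<sigma>(1)] Q_poly_relabel[OF \<sigma>(1)] by (simp add: coeff_map_def)
    ultimately show False using X(3)[of "r m"] by (metis image_eqI)
  qed
qed

end


section \<open>A global chart\<close>

context overlap_data
begin

lemma one_le_p: "1 \<in> {1..p}"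
  using n_sum by (cases "p = 0") auto

lemma Alpha_1_in_I: "k \<in> {1..p} \<Longrightarrow> Alpha k 1 \<in> I"
  using n_pos[of k] by simp

lemma card_I: "card I = d + p + 1"
proof -
  have "{Alpha k l |k l. k \<in> {1..p} \<and> l \<in> {1..n k}} = (\<lambda>(k, l). Alpha k l) ` (SIGMA k:{1..p}. {1..n k})"
    by auto
  moreover have "inj_on (\<lambda>(k, l). Alpha k l) (SIGMA k:{1..p}. {1..n k})" by (auto simp: inj_on_def)
  ultimately have "card {Alpha k l |k l. k \<in> {1..p} \<and> l \<in> {1..n k}} = d + 1"
    using n_sum by (simp add: card_image)
  moreover have "card (Zeta ` {1..p}) = p" by (simp add: card_image inj_on_def)
  moreover have "finite {Alpha k l |k l. k \<in> {1..p} \<and> l \<in> {1..n k}}"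
    using finite_I by (simp add: param_indices_def)
  ultimately show ?thesis
    unfolding param_indices_def by (subst card_Un_disjoint) auto
qed

text \<open>
  The chart drops the coordinate \<open>\<alpha>\<^bsub>1,1\<^esub>\<close>, which the hyperplane equation recovers, and numbers
  the remaining \<open>d + p\<close> coordinates in an arbitrary way.
\<close>

definition chart_index :: "nat \<Rightarrow> param_index" where
  "chart_index = (SOME b. bij_betw b {..<d + p} (I - {Alpha 1 1}))"

lemma bij_chart_index: "bij_betw chart_index {..<d + p} (I - {Alpha 1 1})"
proof -
  have "card (I - {Alpha 1 1}) = card {..<d + p}"
    using card_I Alpha_1_in_I[OF one_le_p] finite_I by (simp add: card_Diff_singleton)
  then have "\<exists>b. bij_betw b {..<d + p} (I - {Alpha 1 1})"
    using finite_I by (intro finite_same_card_bij) auto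
  then show ?thesis unfolding chart_index_def by (rule someI_ex)
qed

definition index_of :: "param_index \<Rightarrow> nat" where
  "index_of = inv_into {..<d + p} chart_index"

lemma chart_index_mem: "i < d + p \<Longrightarrow> chart_index i \<in> I - {Alpha 1 1}"
  using bij_chart_index by (auto simp: bij_betw_def)

lemma index_of_chart_index: "i < d + p \<Longrightarrow> index_of (chart_index i) = i"
  using bij_chart_index by (simp add: index_of_def bij_betw_def)

lemma
  assumes "i \<in> I - {Alpha 1 1}"
  shows chart_index_of: "chart_index (index_of i) = i" and index_of_less: "index_of i < d + p"
proof -
  have i: "i \<in> chart_index ` {..<d + p}" using bij_chart_index assms by (simp add: bij_betw_def)
  show "chart_index (index_of i) = i" unfolding index_of_def using i by (rule f_inv_into_f)
  show "index_of i < d + p" using inv_into_into[OF i] by (simp add: index_of_def)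
qed

definition chart :: "(param_index \<Rightarrow> complex) \<Rightarrow> nat \<Rightarrow> complex" where
  "chart x = (\<lambda>i. if i < d + p then x (chart_index i) else 0)"

definition unchart :: "(nat \<Rightarrow> complex) \<Rightarrow> param_index \<Rightarrow> complex" where
  "unchart y = (\<lambda>i. if i = Alpha 1 1 then 1 - (\<Sum>k\<in>{1..p} - {1}. y (index_of (Alpha k 1)))
     else if i \<in> I then y (index_of i) else 0)"

lemma chart_cvec: "chart x \<in> cvec {..<d + p}"
  by (simp add: chart_def cvec_def)

lemma unchart_cvec: "unchart y \<in> cvec I"
  using Alpha_1_in_I[OF one_le_p] by (auto simp: unchart_def cvec_def)

lemma chart_unchart: "y \<in> cvec {..<d + p} \<Longrightarrow> chart (unchart y) = y"
  using chart_index_mem index_of_chart_index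
  by (auto simp: chart_def unchart_def cvec_def)

lemma sum_unchart: "(\<Sum>k=1..p. unchart y (Alpha k 1)) = 1"
proof -
  have "unchart y (Alpha k 1) = y (index_of (Alpha k 1))" if "k \<in> {1..p} - {1}" for k
    using that Alpha_1_in_I[of k] by (simp add: unchart_def)
  then have "(\<Sum>k\<in>{1..p} - {1}. unchart y (Alpha k 1)) = (\<Sum>k\<in>{1..p} - {1}. y (index_of (Alpha k 1)))"
    by (rule sum.cong[OF refl])
  then show ?thesis
    by (subst sum.remove[OF _ one_le_p]) (simp_all add: unchart_def)
qed

lemma unchart_chart:
  assumes "x \<in> E"
  shows "unchart (chart x) = x"
proof
  have *: "unchart (chart x) i = x i" if "i \<in> I - {Alpha 1 1}" for i
    using that index_of_less[OF that] chart_index_of[OF that] by (simp add: unchart_def chart_def)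
  fix i
  consider "i \<in> I - {Alpha 1 1}" | "i \<notin> I" | "i = Alpha 1 1" by blast
  then show "unchart (chart x) i = x i"
  proof cases
    case 2
    then show ?thesis using unchart_cvec[of "chart x"] assms E_cvec by (auto simp: cvec_def)
  next
    case 3
    have "(\<Sum>k\<in>{1..p} - {1}. unchart (chart x) (Alpha k 1)) = (\<Sum>k\<in>{1..p} - {1}. x (Alpha k 1))"
      using Alpha_1_in_I by (intro sum.cong refl *) auto
    moreover have "(\<Sum>k=1..p. x (Alpha k 1)) = 1" using assms by (simp add: E_tilde_def)
    ultimately have "unchart (chart x) (Alpha 1 1) + (\<Sum>k\<in>{1..p} - {1}. x (Alpha k 1)) =
        x (Alpha 1 1) + (\<Sum>k\<in>{1..p} - {1}. x (Alpha k 1))"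
      using sum_unchart[of "chart x"] sum.remove[OF finite_atLeastAtMost one_le_p, of "\<lambda>k. x (Alpha k 1)"]
        sum.remove[OF finite_atLeastAtMost one_le_p, of "\<lambda>k. unchart (chart x) (Alpha k 1)"] by simp
    then show ?thesis using 3 by simp
  qed (rule *)
qed

lemma chart_holo: "holo_on I E chart"
proof (rule cdifferentiable_imp_holo_on[OF E_cvec])
  fix y :: "param_index \<Rightarrow> complex" and j assume "y \<in> cvec I"
  then show "cdifferentiable I (\<lambda>z. chart z j) y"
    by (cases "j < d + p")
       (simp_all add: chart_def cdifferentiable_coord cdifferentiable_const finite_I)
qed

lemma unchart_holo: "S \<subseteq> cvec {..<d + p} \<Longrightarrow> holo_on {..<d + p} S unchart"
proof (rule cdifferentiable_imp_holo_on)
  fix y :: "nat \<Rightarrow> complex" and j assume y: "y \<in> cvec {..<d + p}"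
  have "cdifferentiable {..<d + p} (\<lambda>z. 1 - (\<Sum>k\<in>{1..p} - {1}. z (index_of (Alpha k 1)))) y"
    using y by (intro cdifferentiable_diff cdifferentiable_sum cdifferentiable_coord
        cdifferentiable_const) simp_all
  then show "cdifferentiable {..<d + p} (\<lambda>z. unchart z j) y"
    using y by (cases "j = Alpha 1 1"; cases "j \<in> I")
      (simp_all add: unchart_def cdifferentiable_coord cdifferentiable_const)
qed

definition generic :: "(param_index \<Rightarrow> complex) set" where
  "generic = (\<Inter>k\<in>{1..p}. \<Inter>j\<in>{1..p} - {k}. {x. x (Zeta k) \<noteq> x (Zeta j)}) \<inter>
     (\<Inter>k\<in>{1..p}. {x. x (Alpha k (n k)) \<noteq> 0})"

lemma open_generic: "open generic"
  unfolding generic_def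
  by (intro open_Int open_INT ballI open_Collect_neq continuous_on_product_coordinates
      continuous_on_const) auto

lemma E_eq_generic: "E = {x \<in> cvec I. (\<Sum>k=1..p. x (Alpha k 1)) = 1} \<inter> generic"
  by (auto simp: E_tilde_def generic_def inj_on_def)

lemma chart_open: "openin (top_of_set (cvec {..<d + p})) (chart ` E)"
proof -
  have "chart ` E = cvec {..<d + p} \<inter> unchart -` generic"
  proof (intro set_eqI iffI)
    fix y assume "y \<in> chart ` E"
    then show "y \<in> cvec {..<d + p} \<inter> unchart -` generic"
      using chart_cvec unchart_chart E_eq_generic by auto
  next
    fix y assume y: "y \<in> cvec {..<d + p} \<inter> unchart -` generic"
    then have "unchart y \<in> E" using unchart_cvec sum_unchart by (simp add: E_eq_generic)
    moreover have "y = chart (unchart y)" using y chart_unchart by simp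
    ultimately show "y \<in> chart ` E" by blast
  qed
  moreover have "continuous_on (cvec {..<d + p}) unchart"
    by (rule holo_on_imp_continuous_on[OF _ unchart_holo]) simp_all
  ultimately show ?thesis
    using continuous_openin_preimage_gen[OF _ open_generic] by simp
qed

lemma relabel_holo: "holo_on I E (relabel \<sigma>)"
proof (rule cdifferentiable_imp_holo_on[OF E_cvec])
  fix y :: "param_index \<Rightarrow> complex" and j assume "y \<in> cvec I"
  then show "cdifferentiable I (\<lambda>z. relabel \<sigma> z j) y"
    by (cases j) (simp_all add: cdifferentiable_coord finite_I)
qed

lemma coeff_map_holo: "holo_on I E coeff_map"
  by (rule cdifferentiable_imp_holo_on[OF E_cvec]) (rule cdifferentiable_coeff_map)

abbreviation projection :: "(param_index \<Rightarrow> complex) \<Rightarrow> coeff_index \<Rightarrow> complex" where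
  "projection \<equiv> coeff_params d \<circ> Pi_proj p n"

lemma projection_eq: "x \<in> E \<Longrightarrow> projection x = coeff_map x"
  by (simp add: coeff_params_Pi_proj)

lemma projection_holo: "holo_on I E projection"
  using coeff_map_holo holo_on_cong[of E projection coeff_map] projection_eq by blast

lemma projection_image: "U \<subseteq> E \<Longrightarrow> projection ` U = coeff_map ` U"
  using projection_eq by (intro image_cong) auto

lemma quotient: "finite_free_holomorphic_quotient E (relabel ` symmetries) projection I (d + p) chart unchart"
proof
  show "finite (relabel ` symmetries)" using finite_symmetries by simp
  show "id \<in> relabel ` symmetries" using id_symmetries relabel_id by (metis image_eqI)
  show "g x \<in> E" if "g \<in> relabel ` symmetries" "x \<in> E" for g x using that relabel_E by auto
  show "continuous_on E g" if "g \<in> relabel ` symmetries" for g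
    using that holo_on_imp_continuous_on[OF finite_I relabel_holo] by auto
  show "\<exists>h\<in>relabel ` symmetries. \<forall>x\<in>E. h (g x) = x \<and> g (h x) = x"
    if "g \<in> relabel ` symmetries" for g
    using that symmetries_inverse by blast
  show "g = h" if "g \<in> relabel ` symmetries" "h \<in> relabel ` symmetries" "x \<in> E" "g x = h x" for g h x
    using that relabel_free by blast
  show "projection x = projection y \<longleftrightarrow> (\<exists>g\<in>relabel ` symmetries. y = g x)" if "x \<in> E" "y \<in> E" for x y
    unfolding projection_eq[OF that(1)] projection_eq[OF that(2)] using coeff_map_fibre[OF that] by simp
  show "continuous_on E projection"
    using finite_I projection_holo by (rule holo_on_imp_continuous_on)
  show "openin (top_of_set (projection ` E)) (projection ` U)" if "openin (top_of_set E) U" for U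
    unfolding projection_image[OF order_refl] projection_image[OF openin_imp_subset[OF that]]
    using that by (rule coeff_map_open)
  show "finite I" by (rule finite_I)
  show "holo_on I E g" if "g \<in> relabel ` symmetries" for g using that relabel_holo by auto
  show "holo_on I E chart" by (rule chart_holo)
  show "holo_on {..<d + p} (chart ` E) unchart"
    using chart_cvec by (intro unchart_holo) auto
  show "unchart (chart x) = x" if "x \<in> E" for x using that by (rule unchart_chart)
  show "openin (top_of_set (cvec {..<d + p})) (chart ` E)" by (rule chart_open)
qed

end


theorem theorem2:
  fixes d p :: nat and n :: "nat \<Rightarrow> nat"
  assumes "d > 1"
    and "\<forall>k\<in>{1..p}. n k > 0"
    and "(\<Sum>k=1..p. n k) = d + 1"
  shows "Pi_proj p n ` E_tilde p n = overlap_class d p n \<and>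
    holo_on (param_indices p n) (E_tilde p n) (coeff_params d \<circ> Pi_proj p n) \<and>
    (\<exists>\<A>. complex_manifold (d + p) (coeff_params d ` overlap_class d p n) \<A> \<and>
       holomorphic_covering (d + p)
         (E_tilde p n) (submanifold_charts (param_indices p n) (d + p) (E_tilde p n))
         (coeff_params d ` overlap_class d p n) \<A>
         (coeff_params d \<circ> Pi_proj p n) \<and>
       finite_sheeted (E_tilde p n) (coeff_params d \<circ> Pi_proj p n)
         (coeff_params d ` overlap_class d p n))"
proof -
  interpret overlap_data d p n
    using assms by unfold_locales auto
  interpret Q: finite_free_holomorphic_quotient "E_tilde p n" "relabel ` symmetries"
    "coeff_params d \<circ> Pi_proj p n" "param_indices p n" "d + p" chart unchart
    by (rule quotient)
  have image: "(coeff_params d \<circ> Pi_proj p n) ` E_tilde p n = coeff_params d ` overlap_class d p n"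
    unfolding image_comp[symmetric] Pi_proj_image ..
  show ?thesis
    using Pi_proj_image projection_holo Q.complex_manifold_quotient Q.holomorphic_covering_quotient
      Q.finite_sheeted_F
    unfolding image by blast
qed


end
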